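(* Let $\gamma_0>0$ and assume that $\overline F(ux)/\overline F(u)\to x^{-1/\gamma_0}$ as $u\to\infty$ for every $x>0$. Let $J$ be a function satisfying [A1]-[A3], let $\alpha>0$, and let $k=k_n$ be a sequence of integers with $1<k<n$, $k\to\infty$ and $k/n\to0$ as $n\to\infty$. Then, with probability tending to $1$ as $n\to\infty$, there exists a solution $\widehat\gamma_{k,\alpha,J}>0$ (in the unknown $\gamma$) of the estimating equation $$\frac1k\sum_{i=1}^{k}J\left(\frac{i}{k+1}\right)\frac{d}{d\gamma}\ell_{\gamma,J}^{\alpha}\left(\frac{X_{n-i+1:n}}{X_{n-k:n}}\right)=\frac{\alpha}{\alpha+1}\int_1^\infty\frac{d}{d\gamma}\ell_{\gamma,J}^{1+\alpha}(x)\,dx,$$ such that $\widehat\gamma_{k,\alpha,J}\overset{\mathbf P}{\to}\gamma_0$ as $n\to\infty$. (That is, there are random variables $\widehat\gamma_{k,\alpha,J}$ which solve the equation with probability tending to $1$ and converge in probability to $\gamma_0$.)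
   Context: Data: $X_1,X_2,\ldots$ are i.i.d. non-negative random variables on a probability space $(\Omega,\mathcal A,\mathbf P)$ with continuous cumulative distribution function $F$; $\overline F:=1-F$; $X_{1:n}\le\dots\le X_{n:n}$ are the order statistics of $X_1,\dots,X_n$. Assumptions on the weight function $J$ (defined on $(0,1)$ and set to zero elsewhere): [A1] $J$ is continuous, nonincreasing and nonnegative on $(0,1)$ with $\int_0^1J(s)\,ds=1$. [A2] $J$ and its derivatives $J^{(m)}$, $1\le m\le3$, are bounded on $(0,1)$. [A3] $\mathcal L(s):=\frac{J^{(1)}(s)}{J(s)}\log s$ (so implicitly $J>0$ on $(0,1)$) and its derivatives $\mathcal L^{(m)}$, $1\le m\le 3$, are bounded on $(0,1)$. For $\gamma>0$ and $x>1$: $\ell_\gamma(x):=\gamma^{-1}x^{-1-1/\gamma}$, $\ell_{\gamma,J}(x):=J(x^{-1/\gamma})\,\ell_\gamma(x)$, and $\ell_{\gamma,J}^{\alpha}(x):=(\ell_{\gamma,J}(x))^{\alpha}$. *)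

theory Defs
  imports "HOL-Probability.Probability"
begin

text \<open>\<open>order_stat X n i \<omega>\<close> is the order statistic \<open>X\<^bsub>i:n\<^esub>\<close>: the \<open>i\<close>-th smallest of
  \<open>X 1 \<omega>, \<dots>, X n \<omega>\<close>, where \<open>i\<close> is counted from 1 (\<open>1 \<le> i \<le> n\<close>).\<close>

definition order_stat :: "(nat \<Rightarrow> 'a \<Rightarrow> real) \<Rightarrow> nat \<Rightarrow> nat \<Rightarrow> 'a \<Rightarrow> real" where
  "order_stat X n i \<omega> = sort (map (\<lambda>j. X j \<omega>) [1..<Suc n]) ! (i - 1)"

definition iid_with_cdf :: "'a measure \<Rightarrow> (nat \<Rightarrow> 'a \<Rightarrow> real) \<Rightarrow> (real \<Rightarrow> real) \<Rightarrow> bool" where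
  "iid_with_cdf M X F \<longleftrightarrow>
     prob_space.indep_vars M (\<lambda>_. borel) X {1..} \<and>
     (\<forall>i\<ge>1. cdf (distr M borel (X i)) = F)"

text \<open>The derivatives of order \<open>0, \<dots>, 3\<close> exist and are bounded on \<open>(0,1)\<close>. As the interval is
  open, iterating \<^const>\<open>deriv\<close> at its points does not involve values of \<open>f\<close> outside of it.\<close>

definition bounded_derivs_upto3 :: "(real \<Rightarrow> real) \<Rightarrow> bool" where
  "bounded_derivs_upto3 f \<longleftrightarrow>
     (\<forall>m<3. \<forall>s\<in>{0<..<1}. ((deriv ^^ m) f) differentiable (at s)) \<and>
     (\<forall>m\<le>3. bounded (((deriv ^^ m) f) ` {0<..<1}))"

definition weight_A1 :: "(real \<Rightarrow> real) \<Rightarrow> bool" where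
  "weight_A1 J \<longleftrightarrow>
     continuous_on {0<..<1} J \<and> antimono_on {0<..<1} J \<and> (\<forall>s\<in>{0<..<1}. 0 \<le> J s) \<and>
     set_integrable lborel {0<..<1} J \<and> (LBINT s:{0<..<1}. J s) = 1"

definition weight_A2 :: "(real \<Rightarrow> real) \<Rightarrow> bool" where
  "weight_A2 J \<longleftrightarrow> bounded_derivs_upto3 J"

definition weight_A3 :: "(real \<Rightarrow> real) \<Rightarrow> bool" where
  "weight_A3 J \<longleftrightarrow>
     (\<forall>s\<in>{0<..<1}. 0 < J s) \<and> bounded_derivs_upto3 (\<lambda>s. deriv J s / J s * ln s)"

text \<open>The densities below are meant for \<open>\<gamma> > 0\<close> and \<open>x > 1\<close>, where \<open>x powr (- 1 / \<gamma>)\<close> lies in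
  \<open>(0,1)\<close>. If \<open>J\<close> vanishes outside \<open>(0,1)\<close> then \<open>ell_J J \<gamma> x = 0\<close> for \<open>\<gamma> > 0\<close> and \<open>0 \<le> x \<le> 1\<close>.\<close>

definition ell :: "real \<Rightarrow> real \<Rightarrow> real" where
  "ell \<gamma> x = (1 / \<gamma>) * x powr (- 1 - 1 / \<gamma>)"

definition ell_J :: "(real \<Rightarrow> real) \<Rightarrow> real \<Rightarrow> real \<Rightarrow> real" where
  "ell_J J \<gamma> x = J (x powr (- 1 / \<gamma>)) * ell \<gamma> x"

definition estimating_eq ::
  "(nat \<Rightarrow> 'a \<Rightarrow> real) \<Rightarrow> (real \<Rightarrow> real) \<Rightarrow> real \<Rightarrow> nat \<Rightarrow> nat \<Rightarrow> 'a \<Rightarrow> real \<Rightarrow> bool" where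
  "estimating_eq X J \<alpha> n k \<omega> \<gamma> \<longleftrightarrow>
     (1 / real k) * (\<Sum>i=1..k. J (real i / real (k + 1)) *
        deriv (\<lambda>g. ell_J J g (order_stat X n (n - i + 1) \<omega> / order_stat X n (n - k) \<omega>) powr \<alpha>) \<gamma>)
     = \<alpha> / (\<alpha> + 1) * (LBINT x:{1<..}. deriv (\<lambda>g. ell_J J g x powr (1 + \<alpha>)) \<gamma>)"

definition tendsto_in_prob :: "'a measure \<Rightarrow> (nat \<Rightarrow> 'a \<Rightarrow> real) \<Rightarrow> real \<Rightarrow> bool" where
  "tendsto_in_prob M Y c \<longleftrightarrow>
     (\<forall>\<epsilon>>0. (\<lambda>n. measure M {\<omega> \<in> space M. \<bar>Y n \<omega> - c\<bar> > \<epsilon>}) \<longlonglongrightarrow> 0)"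

end

theory Submission
  imports Defs
begin

text \<open>Write \<open>Y i\<close> for the ratio of the \<open>i\<close>-th largest to the \<open>(k + 1)\<close>-th largest observation. The
  derivative in \<open>\<gamma>\<close> of the objective
  \<open>1/k * (\<Sum>i=1..k. J (i/(k+1)) * ell_J J \<gamma> (Y i) powr \<alpha>) - \<alpha>/(\<alpha>+1) * \<integral> ell_J J \<gamma> x powr (1+\<alpha>) dx\<close>
  is the difference of the two sides of the estimating equation, so any interior local maximum solves it.
  Pointwise in \<open>\<gamma>\<close> the objective converges in probability to minus a density power divergence (up to
  scale and a constant), which by Young's inequality has its strict maximum at \<open>\<gamma>\<^sub>0\<close>. Hence with
  probability tending to one its value at \<open>\<gamma>\<^sub>0\<close> exceeds the values at \<open>\<gamma>\<^sub>0 \<plusminus> \<epsilon>\<close>, and there is a solution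
  within \<open>\<epsilon>\<close> of \<open>\<gamma>\<^sub>0\<close>; letting \<open>\<epsilon>\<close> decrease slowly with \<open>n\<close> gives consistency. The convergence rests
  on \<open>Y i \<rightarrow> s powr - \<gamma>\<^sub>0\<close> when \<open>i / k \<rightarrow> s\<close>, which follows from Chebyshev's inequality for the number of
  observations above a high threshold. Ties and a vanishing denominator do no harm: the ratio is then \<open>1\<close>
  or \<open>0\<close>, and \<open>ell_J\<close> vanishes there for every \<open>\<gamma> > 0\<close>.\<close>

subsection \<open>Order statistics and convergence in probability\<close>

text \<open>In a sorted list the entries at most \<open>c\<close> form an initial segment, so its
  length decides on which side of \<open>c\<close> the entry at index \<open>r\<close> lies.\<close>

lemma sorted_nth_le_iff:
  fixes xs :: "real list"
  assumes "sorted xs" "r < length xs"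
  shows "xs ! r \<le> c \<longleftrightarrow> r < length (filter (\<lambda>x. x \<le> c) xs)"
  using assms
proof (induction xs arbitrary: r)
  case (Cons x xs)
  show ?case
  proof (cases r)
    case 0
    have "filter (\<lambda>x. x \<le> c) xs = []" if "\<not> x \<le> c"
      using that Cons.prems(1) by (auto simp: filter_empty_conv)
    then show ?thesis using 0 by auto
  next
    case (Suc r')
    have "x \<le> xs ! r'" using Cons.prems Suc by simp
    moreover have "filter (\<lambda>x. x \<le> c) xs = []" if "\<not> x \<le> c"
      using that Cons.prems Suc by (fastforce simp: filter_empty_conv)
    ultimately show ?thesis using Suc Cons by auto
  qed
qed auto

lemma filter_sort_length: "length (filter P (sort xs)) = length (filter P xs)"
  by (metis mset_filter mset_sort size_mset)

text \<open>Unlike an order statistic, this is a sum of indicators of the single observations, so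
  its mean and variance can be computed.\<close>

definition tail_count :: "(nat \<Rightarrow> 'a \<Rightarrow> real) \<Rightarrow> nat \<Rightarrow> real \<Rightarrow> 'a \<Rightarrow> nat" where
  "tail_count X n c \<omega> = card {j\<in>{1..n}. c < X j \<omega>}"

text \<open>Position \<open>n - m + 1\<close> from below holds the \<open>m\<close>-th largest
  value, hence the switch between ranks and counts. Both the measurability and the limits of order
  statistics are obtained from counts through it.\<close>

lemma order_stat_gt_iff:
  assumes "1 \<le> m" "m \<le> n"
  shows "c < order_stat X n (n - m + 1) \<omega> \<longleftrightarrow> m \<le> tail_count X n c \<omega>"
proof -
  let ?xs = "map (\<lambda>j. X j \<omega>) [1..<Suc n]"
  have "order_stat X n (n - m + 1) \<omega> \<le> c \<longleftrightarrow> n - m < length (filter (\<lambda>x. x \<le> c) (sort ?xs))"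
    unfolding order_stat_def using assms by (subst sorted_nth_le_iff) auto
  also have "length (filter (\<lambda>x. x \<le> c) (sort ?xs)) = length (filter (\<lambda>x. x \<le> c) ?xs)"
    by (rule filter_sort_length)
  also have "\<dots> = card {j\<in>{1..n}. X j \<omega> \<le> c}"
    by (auto simp: filter_map o_def distinct_length_filter intro!: arg_cong[where f=card])
  finally have 1: "order_stat X n (n - m + 1) \<omega> \<le> c \<longleftrightarrow> n - m < card {j\<in>{1..n}. X j \<omega> \<le> c}" .
  have "card {1..n} = card {j\<in>{1..n}. X j \<omega> \<le> c} + card {j\<in>{1..n}. c < X j \<omega>}"
    by (subst card_Un_disjoint[symmetric]) (auto intro!: arg_cong[where f=card] simp del: card_atLeastAtMost)
  then show ?thesis using 1 assms unfolding tail_count_def by auto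
qed

lemma tail_count_eq_sum:
  "real (tail_count X n c \<omega>) = (\<Sum>j\<in>{1..n}. indicator {c<..} (X j \<omega>))"
  unfolding tail_count_def by (simp add: indicator_def Int_def of_bool_def[symmetric] sum.If_cases)

lemma tail_count_measurable [measurable]:
  assumes "\<And>j. 1 \<le> j \<Longrightarrow> X j \<in> borel_measurable M"
  shows "(\<lambda>\<omega>. real (tail_count X n c \<omega>)) \<in> borel_measurable M"
  unfolding tail_count_eq_sum using assms by (intro borel_measurable_sum) simp

lemma order_stat_measurable:
  assumes "\<And>j. 1 \<le> j \<Longrightarrow> X j \<in> borel_measurable M" "1 \<le> m" "m \<le> n"
  shows "order_stat X n (n - m + 1) \<in> borel_measurable M"
proof (rule borel_measurableI_greater)
  fix c
  note [measurable] = tail_count_measurable[OF assms(1), where n=n and c=c]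
  have "{\<omega> \<in> space M. c < order_stat X n (n - m + 1) \<omega>}
      = {\<omega> \<in> space M. real m \<le> real (tail_count X n c \<omega>)}"
    by (simp only: order_stat_gt_iff[OF assms(2,3)] of_nat_le_iff)
  also have "\<dots> \<in> sets M" by measurable
  finally show "{\<omega> \<in> space M. c < order_stat X n (n - m + 1) \<omega>} \<in> sets M" .
qed

lemma order_stat_nonneg:
  assumes "\<And>j. 1 \<le> j \<Longrightarrow> 0 \<le> X j \<omega>" "1 \<le> m" "m \<le> n"
  shows "0 \<le> order_stat X n (n - m + 1) \<omega>"
proof -
  let ?xs = "map (\<lambda>j. X j \<omega>) [1..<Suc n]"
  have "sort ?xs ! (n - m) \<in> set (sort ?xs)" using assms by (intro nth_mem) auto
  then show ?thesis using assms(1) unfolding order_stat_def by auto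
qed

section \<open>Convergence in probability to a constant\<close>

lemma tendsto_in_prob_cong:
  assumes "\<forall>\<^sub>F n in sequentially. \<forall>\<omega>\<in>space M. U n \<omega> = V n \<omega>"
  shows "tendsto_in_prob M U a \<longleftrightarrow> tendsto_in_prob M V a"
  unfolding tendsto_in_prob_def
  by (intro all_cong1 imp_cong refl filterlim_cong eventually_mono[OF assms] arg_cong[where f="measure M"]) auto

text \<open>Continuous mapping theorem for two sequences with constant limits. Continuity is asked
  for at the limit point alone, so that quotients are covered.\<close>

lemma (in prob_space) tendsto_in_prob_isCont2:
  fixes f :: "real \<times> real \<Rightarrow> real"
  assumes [measurable]: "\<And>n. Y n \<in> borel_measurable M" "\<And>n. Z n \<in> borel_measurable M"
    and Y: "tendsto_in_prob M Y a" and Z: "tendsto_in_prob M Z b" and f: "isCont f (a, b)"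
  shows "tendsto_in_prob M (\<lambda>n \<omega>. f (Y n \<omega>, Z n \<omega>)) (f (a, b))"
  unfolding tendsto_in_prob_def
proof safe
  fix \<epsilon> :: real assume "\<epsilon> > 0"
  then obtain \<delta> where \<delta>: "\<delta> > 0" "\<And>p. dist p (a, b) < \<delta> \<Longrightarrow> dist (f p) (f (a, b)) < \<epsilon>"
    using f unfolding continuous_at_eps_delta by blast
  \<comment> \<open>With thirds, two small coordinate deviations add up to at most
    \<open>2 * \<delta> / 3\<close>, which is strictly below \<open>\<delta>\<close>; halves would
    give only the weak inequality.\<close>
  have sub: "{\<omega> \<in> space M. \<bar>f (Y n \<omega>, Z n \<omega>) - f (a, b)\<bar> > \<epsilon>} \<subseteq>
     {\<omega> \<in> space M. \<bar>Y n \<omega> - a\<bar> > \<delta> / 3} \<union> {\<omega> \<in> space M. \<bar>Z n \<omega> - b\<bar> > \<delta> / 3}" (is "_ \<subseteq> ?A n \<union> ?B n") for n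
  proof safe
    fix \<omega> assume *: "\<omega> \<in> space M" "\<bar>f (Y n \<omega>, Z n \<omega>) - f (a, b)\<bar> > \<epsilon>" "\<not> \<bar>Z n \<omega> - b\<bar> > \<delta> / 3"
    show "\<bar>Y n \<omega> - a\<bar> > \<delta> / 3"
    proof (rule ccontr)
      assume "\<not> \<bar>Y n \<omega> - a\<bar> > \<delta> / 3"
      moreover have "dist (Y n \<omega>, Z n \<omega>) (a, b) \<le> \<bar>Y n \<omega> - a\<bar> + \<bar>Z n \<omega> - b\<bar>"
        unfolding dist_Pair_Pair dist_real_def using sqrt_sum_squares_le_sum_abs by (metis power2_abs abs_abs)
      ultimately have "dist (Y n \<omega>, Z n \<omega>) (a, b) < \<delta>" using * \<delta>(1) by linarith
      from \<delta>(2)[OF this] * show False by (simp add: dist_real_def)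
    qed
  qed
  have le: "prob {\<omega> \<in> space M. \<bar>f (Y n \<omega>, Z n \<omega>) - f (a, b)\<bar> > \<epsilon>} \<le> prob (?A n) + prob (?B n)" for n
    by (rule order.trans[OF finite_measure_mono[OF sub] measure_Un_le]) measurable
  have "(\<lambda>n. prob (?A n) + prob (?B n)) \<longlonglongrightarrow> 0 + 0"
    using Y[unfolded tendsto_in_prob_def, rule_format, of "\<delta> / 3"]
      Z[unfolded tendsto_in_prob_def, rule_format, of "\<delta> / 3"] \<delta>(1) by (intro tendsto_add) simp_all
  then show "(\<lambda>n. prob {\<omega> \<in> space M. \<bar>f (Y n \<omega>, Z n \<omega>) - f (a, b)\<bar> > \<epsilon>}) \<longlonglongrightarrow> 0"
    unfolding add_0_left by (rule Lim_null_comparison[rotated]) (intro always_eventually allI, simp only: real_norm_def abs_of_nonneg[OF measure_nonneg], rule le)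
qed

lemma (in prob_space) tendsto_in_prob_isCont:
  fixes f :: "real \<Rightarrow> real"
  assumes "\<And>n. Y n \<in> borel_measurable M" "tendsto_in_prob M Y a" "isCont f a"
  shows "tendsto_in_prob M (\<lambda>n \<omega>. f (Y n \<omega>)) (f a)"
  using tendsto_in_prob_isCont2[OF assms(1) assms(1) assms(2) assms(2), of "\<lambda>p. f (fst p)"] assms(3)
  by (simp add: isCont_fst isCont_o2)

text \<open>Bounded convergence: the deviation is at most \<open>\<epsilon> / 2\<close> off the
  event \<open>A n\<close> and at most \<open>C\<close> on it, and the probability of
  \<open>A n\<close> tends to 0.\<close>

lemma (in prob_space) tendsto_in_prob_expectation_abs:
  assumes [measurable]: "\<And>n. Y n \<in> borel_measurable M" and Y: "tendsto_in_prob M Y a"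
    and bound: "\<And>n \<omega>. \<omega> \<in> space M \<Longrightarrow> \<bar>Y n \<omega> - a\<bar> \<le> C"
  shows "(\<lambda>n. expectation (\<lambda>\<omega>. \<bar>Y n \<omega> - a\<bar>)) \<longlonglongrightarrow> 0"
proof (rule LIMSEQ_I)
  fix \<epsilon> :: real assume "\<epsilon> > 0"
  define A where "A n = {\<omega> \<in> space M. \<bar>Y n \<omega> - a\<bar> > \<epsilon> / 2}" for n
  have [measurable]: "A n \<in> sets M" for n unfolding A_def by measurable
  have C: "C \<ge> 0" using bound[of _ 0] not_empty by fastforce
  have le: "expectation (\<lambda>\<omega>. \<bar>Y n \<omega> - a\<bar>) \<le> \<epsilon> / 2 + C * prob (A n)" for n
  proof -
    have int: "integrable M (\<lambda>\<omega>. C * indicator (A n) \<omega>)"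
      by (intro integrable_mult_right integrable_real_indicator) (auto simp: emeasure_eq_measure)
    have "expectation (\<lambda>\<omega>. \<bar>Y n \<omega> - a\<bar>) \<le> expectation (\<lambda>\<omega>. \<epsilon> / 2 + C * indicator (A n) \<omega>)"
    proof (intro integral_mono)
      show "integrable M (\<lambda>\<omega>. \<bar>Y n \<omega> - a\<bar>)" 
        by (rule integrable_const_bound[of _ C]) (use bound in auto)
      show "\<bar>Y n \<omega> - a\<bar> \<le> \<epsilon> / 2 + C * indicator (A n) \<omega>" if "\<omega> \<in> space M" for \<omega>
        using bound[OF that, of n] that C \<open>\<epsilon> > 0\<close> by (auto simp: indicator_def A_def)
      show "integrable M (\<lambda>\<omega>. \<epsilon> / 2 + C * indicator (A n) \<omega>)"
        by (intro Bochner_Integration.integrable_add integrable_const int)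
    qed
    also have "\<dots> = expectation (\<lambda>\<omega>. \<epsilon> / 2) + expectation (\<lambda>\<omega>. C * indicator (A n) \<omega>)"
      by (intro Bochner_Integration.integral_add integrable_const int)
    also have "\<dots> = \<epsilon> / 2 + C * prob (A n)" by (simp add: prob_space)
    finally show ?thesis .
  qed
  have "(\<lambda>n. C * prob (A n)) \<longlonglongrightarrow> C * 0"
    using Y[unfolded tendsto_in_prob_def, rule_format, of "\<epsilon> / 2"] \<open>\<epsilon> > 0\<close>
    unfolding A_def by (intro tendsto_mult_left) simp
  then have "\<forall>\<^sub>F n in sequentially. C * prob (A n) < \<epsilon> / 2"
    using \<open>\<epsilon> > 0\<close> by (intro order_tendstoD(2)[of _ 0]) auto
  then have "\<forall>\<^sub>F n in sequentially. norm (expectation (\<lambda>\<omega>. \<bar>Y n \<omega> - a\<bar>) - 0) < \<epsilon>"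
  proof (rule eventually_mono)
    fix n assume "C * prob (A n) < \<epsilon> / 2"
    moreover have "0 \<le> expectation (\<lambda>\<omega>. \<bar>Y n \<omega> - a\<bar>)" by simp
    ultimately show "norm (expectation (\<lambda>\<omega>. \<bar>Y n \<omega> - a\<bar>) - 0) < \<epsilon>"
      using le[of n] unfolding real_norm_def by linarith
  qed
  then show "\<exists>N. \<forall>n\<ge>N. norm (expectation (\<lambda>\<omega>. \<bar>Y n \<omega> - a\<bar>) - 0) < \<epsilon>"
    by (simp add: eventually_sequentially)
qed

text \<open>Markov's inequality. The mean deviation is an \<open>ennreal\<close> integral, so that
  no integrability has to be supplied and the bound can come straight from Fubini.\<close>

lemma (in prob_space) tendsto_in_prob_of_expectation:
  assumes [measurable]: "\<And>n. Y n \<in> borel_measurable M"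
    and lim: "(\<lambda>n. \<integral>\<^sup>+ \<omega>. ennreal \<bar>Y n \<omega> - a\<bar> \<partial>M) \<longlonglongrightarrow> 0"
  shows "tendsto_in_prob M Y a"
  unfolding tendsto_in_prob_def
proof safe
  fix \<epsilon> :: real assume \<epsilon>: "\<epsilon> > 0"
  have le: "emeasure M {\<omega> \<in> space M. \<bar>Y n \<omega> - a\<bar> > \<epsilon>} \<le> ennreal (1 / \<epsilon>) * (\<integral>\<^sup>+ \<omega>. ennreal \<bar>Y n \<omega> - a\<bar> \<partial>M)" for n
  proof -
    have "emeasure M {\<omega> \<in> space M. \<bar>Y n \<omega> - a\<bar> > \<epsilon>}
        \<le> emeasure M {\<omega> \<in> space M. 1 \<le> ennreal (1 / \<epsilon>) * ennreal \<bar>Y n \<omega> - a\<bar>}"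
    proof (rule emeasure_mono, safe)
      fix \<omega> assume "\<epsilon> < \<bar>Y n \<omega> - a\<bar>"
      then have "ennreal 1 \<le> ennreal (1 / \<epsilon> * \<bar>Y n \<omega> - a\<bar>)"
        using \<epsilon> by (intro ennreal_leI) (simp add: field_simps)
      also have "\<dots> = ennreal (1 / \<epsilon>) * ennreal \<bar>Y n \<omega> - a\<bar>"
        using \<epsilon> by (intro ennreal_mult) auto
      finally show "1 \<le> ennreal (1 / \<epsilon>) * ennreal \<bar>Y n \<omega> - a\<bar>"
        by (simp only: ennreal_1)
    qed measurable
    also have "\<dots> \<le> ennreal (1 / \<epsilon>) * (\<integral>\<^sup>+ \<omega>. ennreal \<bar>Y n \<omega> - a\<bar> * indicator (space M) \<omega> \<partial>M)"
      by (rule nn_integral_Markov_inequality) auto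
    also have "(\<integral>\<^sup>+ \<omega>. ennreal \<bar>Y n \<omega> - a\<bar> * indicator (space M) \<omega> \<partial>M) = (\<integral>\<^sup>+ \<omega>. ennreal \<bar>Y n \<omega> - a\<bar> \<partial>M)"
      by (intro nn_integral_cong) auto
    finally show ?thesis .
  qed
  have up: "(\<lambda>n. ennreal (1 / \<epsilon>) * (\<integral>\<^sup>+ \<omega>. ennreal \<bar>Y n \<omega> - a\<bar> \<partial>M)) \<longlonglongrightarrow> 0"
    using ennreal_tendsto_cmult[OF _ lim, of "ennreal (1 / \<epsilon>)"] by simp
  have "(\<lambda>n. emeasure M {\<omega> \<in> space M. \<bar>Y n \<omega> - a\<bar> > \<epsilon>}) \<longlonglongrightarrow> 0"
    by (rule tendsto_sandwich[OF _ always_eventually[OF allI[OF le]] tendsto_const up]) simp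
  then show "(\<lambda>n. prob {\<omega> \<in> space M. \<bar>Y n \<omega> - a\<bar> > \<epsilon>}) \<longlonglongrightarrow> 0"
    unfolding emeasure_eq_measure ennreal_0[symmetric] by (subst (asm) tendsto_ennreal_iff) auto
qed

subsection \<open>Intermediate order statistics under regular variation\<close>

locale regularly_varying_sample = prob_space M for M :: "'a measure" +
  fixes X :: "nat \<Rightarrow> 'a \<Rightarrow> real" and F :: "real \<Rightarrow> real" and \<gamma>\<^sub>0 :: real and k :: "nat \<Rightarrow> nat"
  assumes iid: "iid_with_cdf M X F"
    and X_nonneg: "\<And>i \<omega>. i \<ge> 1 \<Longrightarrow> \<omega> \<in> space M \<Longrightarrow> 0 \<le> X i \<omega>"
    and F_continuous: "continuous_on UNIV F"
    and \<gamma>\<^sub>0_pos: "\<gamma>\<^sub>0 > 0"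
    and regular_variation:
      "\<And>x. x > 0 \<Longrightarrow> ((\<lambda>u. (1 - F (u * x)) / (1 - F u)) \<longlongrightarrow> x powr (- 1 / \<gamma>\<^sub>0)) at_top"
    and k_bounds: "\<forall>\<^sub>F n in sequentially. 1 < k n \<and> k n < n"
    and k_at_top: "filterlim k at_top sequentially"
    and k_ratio: "(\<lambda>n. real (k n) / real n) \<longlonglongrightarrow> 0"
begin

section \<open>The common distribution function and its upper quantiles\<close>

lemma X_measurable: "1 \<le> j \<Longrightarrow> X j \<in> borel_measurable M"
  using iid unfolding iid_with_cdf_def indep_vars_def by auto

lemma distr_X: "1 \<le> j \<Longrightarrow> real_distribution (distr M borel (X j))"
  unfolding real_distribution_def real_distribution_axioms_def
  using X_measurable by (auto intro!: prob_space_distr)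

lemma cdf_X: "1 \<le> j \<Longrightarrow> cdf (distr M borel (X j)) = F"
  using iid unfolding iid_with_cdf_def by auto

lemma F_mono: "x \<le> y \<Longrightarrow> F x \<le> F y"
  using finite_borel_measure.cdf_nondecreasing[of "distr M borel (X 1)" x y] distr_X[of 1] cdf_X[of 1]
  by (simp add: real_distribution.finite_borel_measure_M)

lemma F_at_top: "(F \<longlongrightarrow> 1) at_top"
  using real_distribution.cdf_lim_at_top_prob[OF distr_X[of 1]] cdf_X[of 1] by simp

lemma F_at_bot: "(F \<longlongrightarrow> 0) at_bot"
  using finite_borel_measure.cdf_lim_at_bot[of "distr M borel (X 1)"] distr_X[of 1] cdf_X[of 1]
  by (simp add: real_distribution.finite_borel_measure_M)

lemma F_le_1: "F x \<le> 1"
  using real_distribution.cdf_bounded_prob[OF distr_X[of 1], of x] cdf_X[of 1] by simp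

lemma prob_X_gt: 
  assumes "1 \<le> j" 
  shows "prob {\<omega> \<in> space M. c < X j \<omega>} = 1 - F c"
proof -
  note [measurable] = X_measurable[OF assms]
  have "F c = prob {\<omega> \<in> space M. X j \<omega> \<le> c}"
    using cdf_X[OF assms] unfolding cdf_def
    by (subst (asm) fun_eq_iff) (auto simp: measure_distr vimage_def Int_def conj_commute)
  moreover have "prob {\<omega> \<in> space M. \<not> X j \<omega> \<le> c} = 1 - prob {\<omega> \<in> space M. X j \<omega> \<le> c}"
    by (rule prob_neg) measurable
  ultimately show ?thesis by (simp add: not_le)
qed

text \<open>If \<open>F\<close> reached 1, the tail would vanish from there on. As
  \<open>0 / 0 = 0\<close>, the quotient in \<open>regular_variation\<close> at \<open>x = 1\<close>
  would then be 0 eventually, whereas its limit is 1.\<close>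

lemma F_less_1: "F u < 1"
proof (rule ccontr)
  assume "\<not> F u < 1"
  then have F1: "F v = 1" if "v \<ge> u" for v using F_mono[OF that] F_le_1[of v] by simp
  have "\<forall>\<^sub>F v in at_top. (1 - F (v * 1)) / (1 - F v) = 0"
    using eventually_ge_at_top[of u] by eventually_elim (simp add: F1)
  from Lim_transform_eventually[OF regular_variation[of 1] this]
  have "((\<lambda>v::real. 0::real) \<longlongrightarrow> 1) at_top" by simp
  then show False by (simp add: tendsto_const_iff)
qed

text \<open>Intermediate value theorem; the continuity of \<open>F\<close> enters here.\<close>

lemma quantile_exists:
  assumes "0 < p" "p < 1"
  shows "\<exists>b. 1 - F b = p"
proof -
  have "\<forall>\<^sub>F x in at_top. F x > 1 - p" using F_at_top assms by (intro order_tendstoD) auto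
  then obtain y where y: "F y > 1 - p" by (auto simp: eventually_at_top_linorder)
  have "\<forall>\<^sub>F x in at_bot. F x < 1 - p" using F_at_bot assms by (intro order_tendstoD) auto
  then obtain x where x: "F x < 1 - p" by (auto simp: eventually_at_bot_linorder)
  have "x \<le> y" using F_mono[of y x] x y by linarith
  then obtain b where "F b = 1 - p"
    using IVT'[of F x "1 - p" y] x y continuous_on_subset[OF F_continuous] by auto
  then show ?thesis by (intro exI[of _ b]) simp
qed

text \<open>A quantile of order \<open>1 - k n / n\<close>: the deterministic scale of the upper
  order statistics. \<open>F\<close> may be constant on intervals, so some such point is
  chosen.\<close>

definition quantile :: "nat \<Rightarrow> real" where
  "quantile n = (SOME b. 1 - F b = real (k n) / real n)"

lemma quantile: "\<forall>\<^sub>F n in sequentially. 1 - F (quantile n) = real (k n) / real n"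
  using k_bounds
proof eventually_elim
  case (elim n)
  then have "\<exists>b. 1 - F b = real (k n) / real n" by (intro quantile_exists) auto
  then show ?case unfolding quantile_def by (rule someI_ex)
qed

text \<open>Every \<open>B\<close> has positive tail mass by \<open>F_less_1\<close>, while the tail
  mass at the quantile is \<open>k n / n\<close> and tends to 0.\<close>

lemma quantile_at_top: "filterlim quantile at_top sequentially"
  unfolding filterlim_at_top
proof
  fix B
  have "\<forall>\<^sub>F n in sequentially. real (k n) / real n < 1 - F B"
    using k_ratio F_less_1[of B] by (intro order_tendstoD) auto
  then show "\<forall>\<^sub>F n in sequentially. B \<le> quantile n"
    using quantile
  proof eventually_elim
    case (elim n)
    then have "F B \<le> F (quantile n)" by linarith
    then show ?case using F_mono[of "quantile n" B] elim by linarith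
  qed
qed

text \<open>Regular variation along \<open>u = quantile n\<close>, where the denominator is
  \<open>k n / n\<close>. The sequence is the expected number of observations above
  \<open>quantile n * x\<close>, in units of \<open>k n\<close>.\<close>

lemma tail_at_quantile:
  assumes "x > 0"
  shows "(\<lambda>n. real n * (1 - F (quantile n * x)) / real (k n)) \<longlonglongrightarrow> x powr (- 1 / \<gamma>\<^sub>0)"
proof -
  have "(\<lambda>n. (1 - F (quantile n * x)) / (1 - F (quantile n))) \<longlonglongrightarrow> x powr (- 1 / \<gamma>\<^sub>0)"
    by (rule filterlim_compose[OF regular_variation[OF assms] quantile_at_top])
  moreover have "\<forall>\<^sub>F n in sequentially. (1 - F (quantile n * x)) / (1 - F (quantile n))
      = real n * (1 - F (quantile n * x)) / real (k n)"
    using quantile k_bounds by eventually_elim simp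
  ultimately show ?thesis by (rule Lim_transform_eventually)
qed

section \<open>Law of large numbers for counts above a high threshold\<close>

lemma tail_count_rv: "(\<lambda>\<omega>. real (tail_count X n c \<omega>)) \<in> borel_measurable M"
  by (intro tail_count_measurable X_measurable)

lemma integrable_X_gt: "1 \<le> j \<Longrightarrow> integrable M (\<lambda>\<omega>. indicator {c<..} (X j \<omega>) :: real)"
  using X_measurable[of j] by (intro integrable_const_bound[of _ 1]) (auto simp: indicator_def)

lemma expectation_X_gt:
  assumes "1 \<le> j"
  shows "expectation (\<lambda>\<omega>. indicator {c<..} (X j \<omega>)) = 1 - F c"
proof -
  note [measurable] = X_measurable[OF assms]
  have "expectation (\<lambda>\<omega>. indicator {c<..} (X j \<omega>)) = expectation (indicator {\<omega> \<in> space M. c < X j \<omega>})"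
    by (intro Bochner_Integration.integral_cong) (auto simp: indicator_def)
  also have "\<dots> = prob {\<omega> \<in> space M. c < X j \<omega>}" by simp
  finally show ?thesis using prob_X_gt[OF assms] by simp
qed

lemma tail_count_expectation: "expectation (\<lambda>\<omega>. real (tail_count X n c \<omega>)) = real n * (1 - F c)"
  unfolding tail_count_eq_sum
  by (subst Bochner_Integration.integral_sum) (auto simp: expectation_X_gt integrable_X_gt)

text \<open>The binomial variance \<open>n * p * (1 - p)\<close>, from expanding the square of a sum
  of centred indicators; independence removes the off-diagonal terms.\<close>

lemma tail_count_variance:
  "variance (\<lambda>\<omega>. real (tail_count X n c \<omega>)) \<le> real n * (1 - F c)"
proof -
  define p where "p = 1 - F c"
  define Y where "Y j \<omega> = indicator {c<..} (X j \<omega>) - p" for j \<omega>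
  have p: "0 \<le> p" using F_le_1[of c] by (simp add: p_def)
  have p1: "p \<le> 1" using prob_X_gt[of 1 c] p_def by (metis order_refl prob_le_1)
  have meas [measurable]: "Y j \<in> borel_measurable M" if "1 \<le> j" for j
    unfolding Y_def using X_measurable[OF that] by measurable
  have bnd: "\<bar>Y j \<omega>\<bar> \<le> 1" for j \<omega> unfolding Y_def using p p1 by (auto simp: indicator_def)
  have int: "integrable M (Y j)" if "1 \<le> j" for j
    using meas[OF that] by (intro integrable_const_bound[of _ 1]) (auto simp: bnd)
  have int2: "integrable M (\<lambda>\<omega>. Y i \<omega> * Y j \<omega>)" if "1 \<le> i" "1 \<le> j" for i j
    using meas[OF that(1)] meas[OF that(2)]
    by (intro integrable_const_bound[of _ 1]) (auto simp: abs_mult bnd mult_le_one)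
  have ind: "expectation (\<lambda>\<omega>. indicator {c<..} (X j \<omega>)) = p" if "1 \<le> j" for j
    using expectation_X_gt[OF that] unfolding p_def .
  have iint: "integrable M (\<lambda>\<omega>. indicator {c<..} (X j \<omega>) :: real)" if "1 \<le> j" for j
    using integrable_X_gt[OF that] .
  have EY: "expectation (Y j) = 0" if "1 \<le> j" for j
    unfolding Y_def using ind[OF that] iint[OF that] by (simp add: prob_space)
  have EYY: "expectation (\<lambda>\<omega>. Y i \<omega> * Y j \<omega>) = (if i = j then p * (1 - p) else 0)"
    if ij: "1 \<le> i" "1 \<le> j" for i j
  proof (cases "i = j")
    case True
    \<comment> \<open>An indicator equals its square, so the squared centred indicator is an affine
      function of the indicator.\<close>
    have "Y j \<omega> * Y j \<omega> = (1 - 2 * p) * indicator {c<..} (X j \<omega>) + p\<^sup>2" for \<omega>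
      unfolding Y_def by (auto simp: indicator_def power2_eq_square algebra_simps)
    then have "expectation (\<lambda>\<omega>. Y j \<omega> * Y j \<omega>) = (1 - 2 * p) * p + p\<^sup>2"
      using ind[OF ij(2)] iint[OF ij(2)] by (simp add: prob_space)
    then show ?thesis using True by (simp add: power2_eq_square algebra_simps)
  next
    case False
    have "indep_vars (\<lambda>_. borel) X {i, j}"
      using iid ij unfolding iid_with_cdf_def by (auto intro: indep_vars_subset)
    then have "indep_vars (\<lambda>_. borel) (\<lambda>j \<omega>. indicator {c<..} (X j \<omega>) - p) {i, j}"
      by (rule indep_vars_compose2) auto
    then have "indep_vars (\<lambda>_. borel) Y {i, j}" unfolding Y_def .
    then have "expectation (\<lambda>\<omega>. \<Prod>l\<in>{i, j}. Y l \<omega>) = (\<Prod>l\<in>{i, j}. expectation (Y l))"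
      using int ij by (intro indep_vars_lebesgue_integral) auto
    then show ?thesis using False EY ij by simp
  qed
  have "variance (\<lambda>\<omega>. real (tail_count X n c \<omega>)) = expectation (\<lambda>\<omega>. (\<Sum>j\<in>{1..n}. Y j \<omega>)\<^sup>2)"
    unfolding tail_count_expectation
    by (simp add: tail_count_eq_sum Y_def sum_subtractf p_def)
  also have "\<dots> = expectation (\<lambda>\<omega>. \<Sum>i\<in>{1..n}. \<Sum>j\<in>{1..n}. Y i \<omega> * Y j \<omega>)"
    by (simp add: power2_eq_square sum_product)
  also have "\<dots> = (\<Sum>i\<in>{1..n}. \<Sum>j\<in>{1..n}. expectation (\<lambda>\<omega>. Y i \<omega> * Y j \<omega>))"
    by (subst Bochner_Integration.integral_sum)
      (auto intro!: Bochner_Integration.integrable_sum int2 Bochner_Integration.integral_sum sum.cong)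
  also have "\<dots> = (\<Sum>i\<in>{1..n}. \<Sum>j\<in>{1..n}. if i = j then p * (1 - p) else 0)"
    by (intro sum.cong EYY refl) auto
  also have "\<dots> = real n * (p * (1 - p))" by simp
  also have "\<dots> \<le> real n * p" using p by (intro mult_left_mono) (auto simp: algebra_simps)
  finally show ?thesis unfolding p_def .
qed

text \<open>The variance is at most the mean and the mean is of order \<open>k n\<close>. After
  division by \<open>k n\<close> the variance is of order \<open>1 / k n\<close>, and Chebyshev's
  inequality applies.\<close>

lemma tail_count_tendsto:
  assumes "x > 0"
  shows "tendsto_in_prob M (\<lambda>n \<omega>. real (tail_count X n (quantile n * x) \<omega>) / real (k n)) (x powr (- 1 / \<gamma>\<^sub>0))"
  unfolding tendsto_in_prob_def
proof safe
  fix \<epsilon> :: real assume \<epsilon>: "\<epsilon> > 0"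
  define c where "c n = quantile n * x" for n
  define q where "q n = real n * (1 - F (c n)) / real (k n)" for n
  have q: "q \<longlonglongrightarrow> x powr (- 1 / \<gamma>\<^sub>0)"
    using tail_at_quantile[OF assms] unfolding q_def c_def .
  have k_inf: "filterlim (\<lambda>n. real (k n)) at_top sequentially"
    by (rule filterlim_compose[OF filterlim_real_sequentially k_at_top])
  let ?A = "\<lambda>n. {\<omega> \<in> space M. \<bar>real (tail_count X n (c n) \<omega>) / real (k n) - x powr (- 1 / \<gamma>\<^sub>0)\<bar> > \<epsilon>}"
  have "\<forall>\<^sub>F n in sequentially. \<bar>q n - x powr (- 1 / \<gamma>\<^sub>0)\<bar> < \<epsilon> / 2"
    using tendstoD[OF q, of "\<epsilon> / 2"] \<epsilon> by (simp add: dist_real_def)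
  \<comment> \<open>One half of \<open>\<epsilon>\<close> absorbs the distance of \<open>q n\<close>
    from its limit, the other half is left for the deviation from the mean. Chebyshev at
    \<open>\<epsilon> / 2 * k n\<close> with variance at most \<open>q n * k n\<close> gives the
    factor \<open>4 / \<epsilon>\<^sup>2\<close>.\<close>
  then have ev: "\<forall>\<^sub>F n in sequentially. norm (prob (?A n)) \<le> 4 / \<epsilon>\<^sup>2 * (q n * (1 / real (k n)))"
    using k_bounds
  proof eventually_elim
    case (elim n)
    have k: "real (k n) > 0" using elim by simp
    define N where "N \<omega> = real (tail_count X n (c n) \<omega>)" for \<omega>
    have [measurable]: "N \<in> borel_measurable M" unfolding N_def by (rule tail_count_rv)
    have EN: "expectation N = q n * real (k n)"
      unfolding N_def tail_count_expectation q_def using k by simp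
    have "?A n \<subseteq> {\<omega> \<in> space M. \<epsilon> / 2 * real (k n) \<le> \<bar>N \<omega> - expectation N\<bar>}"
    proof safe
      fix \<omega> assume "\<bar>real (tail_count X n (c n) \<omega>) / real (k n) - x powr (- 1 / \<gamma>\<^sub>0)\<bar> > \<epsilon>"
      then have "\<epsilon> / 2 \<le> \<bar>N \<omega> / real (k n) - q n\<bar>" using elim(1) unfolding N_def by linarith
      also have "N \<omega> / real (k n) - q n = (N \<omega> - expectation N) / real (k n)"
        using k EN by (simp add: field_simps)
      finally show "\<epsilon> / 2 * real (k n) \<le> \<bar>N \<omega> - expectation N\<bar>" using k by (simp add: field_simps)
    qed
    then have "prob (?A n) \<le> prob {\<omega> \<in> space M. \<epsilon> / 2 * real (k n) \<le> \<bar>N \<omega> - expectation N\<bar>}"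
      by (intro finite_measure_mono) auto
    also have "\<dots> \<le> variance N / (\<epsilon> / 2 * real (k n))\<^sup>2"
    proof (rule Chebyshev_inequality)
      have "N \<omega> \<le> n" for \<omega> unfolding N_def tail_count_def
        by (rule of_nat_mono) (rule order.trans[OF card_mono[of "{1..n}"]], auto)
      then have "(N \<omega>)\<^sup>2 \<le> (real n)\<^sup>2" for \<omega> by (intro power_mono) (auto simp: N_def)
      then show "integrable M (\<lambda>\<omega>. (N \<omega>)\<^sup>2)"
        by (intro integrable_const_bound[of _ "(real n)\<^sup>2"]) auto
    qed (use k \<epsilon> in auto)
    also have "\<dots> \<le> (real n * (1 - F (c n))) / (\<epsilon> / 2 * real (k n))\<^sup>2"
      unfolding N_def by (intro divide_right_mono tail_count_variance) auto
    also have "real n * (1 - F (c n)) = q n * real (k n)" unfolding q_def using k by simp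
    also have "q n * real (k n) / (\<epsilon> / 2 * real (k n))\<^sup>2 = 4 / \<epsilon>\<^sup>2 * (q n * (1 / real (k n)))"
      using k \<epsilon> by (simp add: power2_eq_square field_simps)
    finally show ?case by simp
  qed
  have "(\<lambda>n. 1 / real (k n)) \<longlonglongrightarrow> 0"
    using tendsto_inverse_0_at_top[OF k_inf] by (simp add: inverse_eq_divide)
  then have lim: "(\<lambda>n. 4 / \<epsilon>\<^sup>2 * (q n * (1 / real (k n)))) \<longlonglongrightarrow> 4 / \<epsilon>\<^sup>2 * (x powr (- 1 / \<gamma>\<^sub>0) * 0)"
    by (intro tendsto_mult q tendsto_const)
  show "(\<lambda>n. prob {\<omega> \<in> space M. \<epsilon> < \<bar>real (tail_count X n (quantile n * x) \<omega>) / real (k n) - x powr (- 1 / \<gamma>\<^sub>0)\<bar>}) \<longlonglongrightarrow> 0"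
    using Lim_null_comparison[OF ev] lim unfolding c_def by simp
qed

section \<open>Order statistics and their ratios\<close>

lemma order_stat_rv:
  assumes "1 \<le> m" "m \<le> n"
  shows "order_stat X n (n - m + 1) \<in> borel_measurable M"
  using order_stat_measurable[OF X_measurable assms] .

text \<open>Inversion of the law for counts: the limiting count
  \<open>x powr (- 1 / \<gamma>\<^sub>0)\<close> decreases in \<open>x\<close> and crosses the level
  \<open>s\<close> exactly at \<open>x = s powr (- \<gamma>\<^sub>0)\<close>. Hence the counts at
  one threshold on each side of this point control the order statistic.\<close>

lemma order_stat_tendsto:
  fixes m :: "nat \<Rightarrow> nat"
  assumes m: "\<forall>\<^sub>F n in sequentially. 1 \<le> m n \<and> m n \<le> n"
    and lim: "(\<lambda>n. real (m n) / real (k n)) \<longlonglongrightarrow> s" and s: "s > 0"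
  shows "tendsto_in_prob M (\<lambda>n \<omega>. order_stat X n (n - m n + 1) \<omega> / quantile n) (s powr (- \<gamma>\<^sub>0))"
  unfolding tendsto_in_prob_def
proof safe
  fix \<epsilon> :: real assume \<epsilon>: "\<epsilon> > 0"
  define r where "r = s powr (- \<gamma>\<^sub>0)"
  \<comment> \<open>The maximum with \<open>r / 2\<close> keeps the lower threshold positive even if
    \<open>\<epsilon>\<close> exceeds \<open>r\<close>, as \<open>tail_count_tendsto\<close>
    requires.\<close>
  define x1 where "x1 = max (r / 2) (r - \<epsilon>)"
  define x2 where "x2 = r + \<epsilon>"
  have r: "r > 0" using s unfolding r_def by simp
  have x: "0 < x1" "x1 < r" "r < x2" using r \<epsilon> unfolding x1_def x2_def by auto
  have rs: "r powr (- 1 / \<gamma>\<^sub>0) = s" unfolding r_def using s \<gamma>\<^sub>0_pos by (simp add: powr_powr)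
  have q1: "x1 powr (- 1 / \<gamma>\<^sub>0) > s" using x \<gamma>\<^sub>0_pos powr_less_mono2_neg[of "-1/\<gamma>\<^sub>0" x1 r] rs by simp
  have q2: "x2 powr (- 1 / \<gamma>\<^sub>0) < s" using x r \<gamma>\<^sub>0_pos powr_less_mono2_neg[of "-1/\<gamma>\<^sub>0" r x2] rs by simp
  let ?N = "\<lambda>n x \<omega>. real (tail_count X n (quantile n * x) \<omega>) / real (k n)"
  define \<delta>1 where "\<delta>1 = (x1 powr (- 1 / \<gamma>\<^sub>0) - s) / 2"
  define \<delta>2 where "\<delta>2 = (s - x2 powr (- 1 / \<gamma>\<^sub>0)) / 2"
  have \<delta>: "\<delta>1 > 0" "\<delta>2 > 0" using q1 q2 unfolding \<delta>1_def \<delta>2_def by auto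
  let ?B1 = "\<lambda>n. {\<omega> \<in> space M. \<bar>?N n x1 \<omega> - x1 powr (- 1 / \<gamma>\<^sub>0)\<bar> > \<delta>1}"
  let ?B2 = "\<lambda>n. {\<omega> \<in> space M. \<bar>?N n x2 \<omega> - x2 powr (- 1 / \<gamma>\<^sub>0)\<bar> > \<delta>2}"
  let ?A = "\<lambda>n. {\<omega> \<in> space M. \<bar>order_stat X n (n - m n + 1) \<omega> / quantile n - r\<bar> > \<epsilon>}"
  have 1: "\<forall>\<^sub>F n in sequentially. real (m n) / real (k n) < s + \<delta>1"
    using lim \<delta> by (intro order_tendstoD) auto
  have 2: "\<forall>\<^sub>F n in sequentially. real (m n) / real (k n) > s - \<delta>2"
    using lim \<delta> by (intro order_tendstoD) auto
  have 3: "\<forall>\<^sub>F n in sequentially. quantile n > 0"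
    using quantile_at_top by (auto simp: filterlim_at_top_dense)
  have ev: "\<forall>\<^sub>F n in sequentially. norm (prob (?A n)) \<le> prob (?B1 n) + prob (?B2 n)"
    using 1 2 3 m k_bounds
  proof eventually_elim
    case (elim n)
    have [measurable]: "?N n x1 \<in> borel_measurable M" "?N n x2 \<in> borel_measurable M"
      by (intro borel_measurable_divide tail_count_rv borel_measurable_const)+
    have "?A n \<subseteq> ?B1 n \<union> ?B2 n"
    proof safe
      fix \<omega> assume \<omega>: "\<omega> \<in> space M" "\<epsilon> < \<bar>order_stat X n (n - m n + 1) \<omega> / quantile n - r\<bar>"
        and n2: "\<not> \<delta>2 < \<bar>?N n x2 \<omega> - x2 powr (- 1 / \<gamma>\<^sub>0)\<bar>"
      have k: "real (k n) > 0" using elim by simp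
      have *: "order_stat X n (n - m n + 1) \<omega> / quantile n > x \<longleftrightarrow> real (m n) / real (k n) \<le> ?N n x \<omega>" for x
      proof -
        have "order_stat X n (n - m n + 1) \<omega> / quantile n > x \<longleftrightarrow> quantile n * x < order_stat X n (n - m n + 1) \<omega>"
          using elim(3) by (simp add: field_simps)
        also have "\<dots> \<longleftrightarrow> m n \<le> tail_count X n (quantile n * x) \<omega>"
          using elim by (intro order_stat_gt_iff) auto
        also have "\<dots> \<longleftrightarrow> real (m n) / real (k n) \<le> ?N n x \<omega>"
          using k by (simp add: divide_le_cancel)
        finally show ?thesis .
      qed
      have aux2: "\<not> t \<le> a" if "\<not> d < \<bar>a - b\<bar>" "d = (s - b) / 2" "s - d < t" for a b d t :: real
        using that by argo
      have aux1: "d < \<bar>a - b\<bar>" if "\<not> t \<le> a" "d = (b - s) / 2" "t < s + d" for a b d t :: real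
        using that by argo
      \<comment> \<open>Off the second event the ratio is at most \<open>r + \<epsilon>\<close>, so
        a deviation beyond \<open>\<epsilon>\<close> is downwards, below
        \<open>r - \<epsilon> \<le> x1\<close>; then the count at \<open>x1\<close> is too small and
        the first event occurs.\<close>
      have "\<not> order_stat X n (n - m n + 1) \<omega> / quantile n > x2"
        unfolding * using aux2 n2 elim(2) \<delta>2_def by blast
      then have "\<not> order_stat X n (n - m n + 1) \<omega> / quantile n > x1"
        using \<omega>(2) unfolding x1_def x2_def by linarith
      then show "\<delta>1 < \<bar>?N n x1 \<omega> - x1 powr (- 1 / \<gamma>\<^sub>0)\<bar>"
        unfolding * using aux1 elim(1) \<delta>1_def by blast
    qed
    then have "prob (?A n) \<le> prob (?B1 n \<union> ?B2 n)" by (intro finite_measure_mono) measurable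
    also have "\<dots> \<le> prob (?B1 n) + prob (?B2 n)" by (intro measure_Un_le) measurable
    finally show ?case by simp
  qed
  have "(\<lambda>n. prob (?B1 n) + prob (?B2 n)) \<longlonglongrightarrow> 0 + 0"
    using tail_count_tendsto[OF x(1)] tail_count_tendsto[of x2] x r \<delta> unfolding tendsto_in_prob_def
    by (intro tendsto_add) (simp_all del: divide_minus_left)
  then show "(\<lambda>n. prob {\<omega> \<in> space M. \<epsilon> < \<bar>order_stat X n (n - m n + 1) \<omega> / quantile n - s powr - \<gamma>\<^sub>0\<bar>}) \<longlonglongrightarrow> 0"
    using Lim_null_comparison[OF ev] unfolding r_def by simp
qed

text \<open>The value \<open>0\<close> outside of the relevant indices makes this a nonnegative random variable for
  all \<open>n\<close> and \<open>i\<close>.\<close>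

definition relative_excess :: "nat \<Rightarrow> nat \<Rightarrow> 'a \<Rightarrow> real" where
  "relative_excess n i \<omega> = (if 1 \<le> i \<and> i \<le> k n \<and> k n < n
     then order_stat X n (n - i + 1) \<omega> / order_stat X n (n - k n) \<omega> else 0)"

lemma relative_excess_nonneg:
  assumes "\<omega> \<in> space M"
  shows "0 \<le> relative_excess n i \<omega>"
proof (cases "1 \<le> i \<and> i \<le> k n \<and> k n < n")
  case True
  then have "0 \<le> order_stat X n (n - i + 1) \<omega>" "0 \<le> order_stat X n (n - Suc (k n) + 1) \<omega>"
    using assms X_nonneg by (intro order_stat_nonneg; simp)+
  \<comment> \<open>The denominator is the \<open>(k n + 1)\<close>-th largest observation, which
    fits the index form of the lemmas on order statistics; the identity relies on
    \<open>k n < n\<close>.\<close>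
  moreover have "n - Suc (k n) + 1 = n - k n" using True by arith
  ultimately show ?thesis unfolding relative_excess_def by simp
qed (auto simp: relative_excess_def)

lemma relative_excess_rv [measurable]: "relative_excess n i \<in> borel_measurable M"
proof (cases "1 \<le> i \<and> i \<le> k n \<and> k n < n")
  case True
  then have "n - Suc (k n) + 1 = n - k n" by arith
  then have [measurable]: "order_stat X n (n - i + 1) \<in> borel_measurable M" "order_stat X n (n - k n) \<in> borel_measurable M"
    using order_stat_rv[of i n] order_stat_rv[of "Suc (k n)" n] True by auto
  show ?thesis unfolding relative_excess_def[abs_def] by measurable
qed (auto simp: relative_excess_def[abs_def])

lemma Suc_k_div_k: "(\<lambda>n. real (Suc (k n)) / real (k n)) \<longlonglongrightarrow> 1"
proof -
  have "(\<lambda>n. 1 + 1 / real (k n)) \<longlonglongrightarrow> 1 + 0"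
    using tendsto_inverse_0_at_top[OF filterlim_compose[OF filterlim_real_sequentially k_at_top]]
    by (intro tendsto_add tendsto_const) (simp add: inverse_eq_divide)
  moreover have "\<forall>\<^sub>F n in sequentially. 1 + 1 / real (k n) = real (Suc (k n)) / real (k n)"
    using k_bounds by eventually_elim (simp add: field_simps)
  ultimately show ?thesis by (auto intro: Lim_transform_eventually)
qed

text \<open>Numerator and denominator have ranks \<open>i n\<close> and \<open>k n + 1\<close> from
  above. Divided by \<open>quantile n\<close> they tend to
  \<open>s powr (- \<gamma>\<^sub>0)\<close> and to 1, and the scale cancels in the
  quotient.\<close>

lemma relative_excess_tendsto:
  assumes i: "\<forall>\<^sub>F n in sequentially. 1 \<le> i n \<and> i n \<le> k n"
    and lim: "(\<lambda>n. real (i n) / real (k n)) \<longlonglongrightarrow> s" and s: "s > 0"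
  shows "tendsto_in_prob M (\<lambda>n. relative_excess n (i n)) (s powr (- \<gamma>\<^sub>0))"
proof -
  define good where "good n \<longleftrightarrow> 1 \<le> i n \<and> i n \<le> k n \<and> k n < n" for n
  have ev_good: "\<forall>\<^sub>F n in sequentially. good n"
    using i k_bounds unfolding good_def by eventually_elim auto
  \<comment> \<open>The value 0 for finitely many bad \<open>n\<close> makes the variables
    measurable for every \<open>n\<close>, as the continuous mapping lemma demands.\<close>
  define Y where "Y n \<omega> = (if good n then order_stat X n (n - i n + 1) \<omega> / quantile n else 0)" for n \<omega>
  define Z where "Z n \<omega> = (if good n then order_stat X n (n - Suc (k n) + 1) \<omega> / quantile n else 0)" for n \<omega>
  have "tendsto_in_prob M Y (s powr (- \<gamma>\<^sub>0))"
  proof (subst tendsto_in_prob_cong)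
    show "tendsto_in_prob M (\<lambda>n \<omega>. order_stat X n (n - i n + 1) \<omega> / quantile n) (s powr (- \<gamma>\<^sub>0))"
    proof (rule order_stat_tendsto[OF _ lim s])
      show "\<forall>\<^sub>F n in sequentially. 1 \<le> i n \<and> i n \<le> n"
        using i k_bounds by eventually_elim auto
    qed
  qed (use ev_good in \<open>auto elim: eventually_mono simp: Y_def\<close>)
  moreover have "tendsto_in_prob M Z (1 powr (- \<gamma>\<^sub>0))"
  proof (subst tendsto_in_prob_cong)
    show "tendsto_in_prob M (\<lambda>n \<omega>. order_stat X n (n - Suc (k n) + 1) \<omega> / quantile n) (1 powr (- \<gamma>\<^sub>0))"
    proof (rule order_stat_tendsto[OF _ Suc_k_div_k])
      show "\<forall>\<^sub>F n in sequentially. 1 \<le> Suc (k n) \<and> Suc (k n) \<le> n"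
        using k_bounds by eventually_elim auto
    qed simp
  qed (use ev_good in \<open>auto elim: eventually_mono simp: Z_def\<close>)
  moreover have "Y n \<in> borel_measurable M" for n
    unfolding Y_def[abs_def] using order_stat_rv[of "i n" n]
    by (cases "good n") (auto simp: good_def intro!: borel_measurable_divide)
  moreover have "Z n \<in> borel_measurable M" for n
    unfolding Z_def[abs_def] using order_stat_rv[of "Suc (k n)" n]
    by (cases "good n") (auto simp: good_def intro!: borel_measurable_divide)
  moreover have "isCont (\<lambda>p. fst p / snd p) (s powr (- \<gamma>\<^sub>0), 1 powr (- \<gamma>\<^sub>0))"
    by (intro continuous_intros) auto
  ultimately have "tendsto_in_prob M (\<lambda>n \<omega>. Y n \<omega> / Z n \<omega>) (s powr (- \<gamma>\<^sub>0))"
    using tendsto_in_prob_isCont2[of Y Z "s powr (- \<gamma>\<^sub>0)" "1 powr (- \<gamma>\<^sub>0)" "\<lambda>p. fst p / snd p"] by simp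
  moreover have "\<forall>\<^sub>F n in sequentially. quantile n > 0"
    using quantile_at_top by (auto simp: filterlim_at_top_dense)
  then have "\<forall>\<^sub>F n in sequentially. \<forall>\<omega>\<in>space M. Y n \<omega> / Z n \<omega> = relative_excess n (i n) \<omega>"
    using ev_good
  proof eventually_elim
    case (elim n)
    then have "n - Suc (k n) + 1 = n - k n" unfolding good_def by arith
    with elim show ?case unfolding good_def Y_def Z_def relative_excess_def by auto
  qed
  ultimately show ?thesis by (subst (asm) tendsto_in_prob_cong)
qed

end

subsection \<open>The weighted Pareto densities\<close>

text \<open>Dominated convergence for difference quotients along sequences; the mean value theorem
  turns the bound \<open>w\<close> on the derivatives into a bound on the quotients.\<close>

lemma has_real_derivative_lebesgue_integral:
  fixes f f' :: "real \<Rightarrow> 'a \<Rightarrow> real"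
  assumes t0: "t0 \<in> {a<..<b}"
    and int: "\<And>t. t \<in> {a<..<b} \<Longrightarrow> integrable M (f t)"
    and der: "\<And>t x. t \<in> {a<..<b} \<Longrightarrow> x \<in> space M \<Longrightarrow> ((\<lambda>t. f t x) has_real_derivative f' t x) (at t)"
    and bound: "\<And>t x. t \<in> {a<..<b} \<Longrightarrow> x \<in> space M \<Longrightarrow> \<bar>f' t x\<bar> \<le> w x"
    and w: "integrable M w"
  shows "((\<lambda>t. \<integral>x. f t x \<partial>M) has_real_derivative (\<integral>x. f' t0 x \<partial>M)) (at t0)"
  unfolding has_field_derivative_iff tendsto_at_iff_sequentially
proof safe
  fix X :: "nat \<Rightarrow> real" assume ne: "\<forall>i. X i \<in> UNIV - {t0}" and X: "X \<longlonglongrightarrow> t0"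
  \<comment> \<open>Outside the interval nothing is known about \<open>f (X n)\<close>; the value 0
    there keeps measurability and domination valid for every \<open>n\<close>.\<close>
  define S where "S n x = (if X n \<in> {a<..<b} then (f (X n) x - f t0 x) / (X n - t0) else 0)" for n x
  have ev: "\<forall>\<^sub>F n in sequentially. X n \<in> {a<..<b}"
    using topological_tendstoD[OF X _ t0] by auto
  have S_meas: "S n \<in> borel_measurable M" for n
    unfolding S_def[abs_def] using int t0 by (cases "X n \<in> {a<..<b}") auto
  have S_lim: "(\<lambda>n. S n x) \<longlonglongrightarrow> f' t0 x" if x: "x \<in> space M" for x
  proof -
    have "(\<lambda>n. (f (X n) x - f t0 x) / (X n - t0)) \<longlonglongrightarrow> f' t0 x"
      using der[OF t0 x] ne X unfolding has_field_derivative_iff tendsto_at_iff_sequentially by (auto simp: o_def)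
    then show ?thesis
      by (rule Lim_transform_eventually) (use ev in \<open>auto elim: eventually_mono simp: S_def\<close>)
  qed
  have S_bound: "\<bar>S n x\<bar> \<le> w x" if x: "x \<in> space M" for n x
  proof (cases "X n \<in> {a<..<b}")
    case True
    have "\<exists>\<xi>\<in>{a<..<b}. f (X n) x - f t0 x = (X n - t0) * f' \<xi> x"
    proof (cases "X n < t0")
      case True
      obtain \<xi> where "\<xi> > X n" "\<xi> < t0" "f t0 x - f (X n) x = (t0 - X n) * f' \<xi> x"
        using MVT2[OF True, of "\<lambda>t. f t x" "\<lambda>t. f' t x"] der x t0 \<open>X n \<in> {a<..<b}\<close> by fastforce
      then show ?thesis using t0 \<open>X n \<in> {a<..<b}\<close> by (intro bexI[of _ \<xi>]) (auto simp: algebra_simps)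
    next
      case False
      then have "t0 < X n" using ne[rule_format, of n] by auto
      then obtain \<xi> where "\<xi> < X n" "\<xi> > t0" "f (X n) x - f t0 x = (X n - t0) * f' \<xi> x"
        using MVT2[of t0 "X n" "\<lambda>t. f t x" "\<lambda>t. f' t x"] der x t0 \<open>X n \<in> {a<..<b}\<close> by fastforce
      then show ?thesis using t0 \<open>X n \<in> {a<..<b}\<close> by (intro bexI[of _ \<xi>]) auto
    qed
    then obtain \<xi> where \<xi>: "\<xi> \<in> {a<..<b}" "f (X n) x - f t0 x = (X n - t0) * f' \<xi> x" by blast
    then have "S n x = f' \<xi> x" using True ne[rule_format, of n] by (simp add: S_def)
    then show ?thesis using bound[OF \<xi>(1) x] by simp
  next
    case False
    have "0 \<le> w x" using bound[OF t0 x] by linarith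
    with False show ?thesis by (auto simp: S_def)
  qed
  \<comment> \<open>Measurability of the derivative is inherited from the difference
    quotients.\<close>
  have meas: "f' t0 \<in> borel_measurable M"
    by (rule borel_measurable_LIMSEQ_real[OF S_lim S_meas])
  have "(\<lambda>n. \<integral>x. S n x \<partial>M) \<longlonglongrightarrow> (\<integral>x. f' t0 x \<partial>M)"
    by (rule integral_dominated_convergence[OF meas S_meas w]) (use S_lim S_bound in auto)
  then show "((\<lambda>y. ((\<integral>x. f y x \<partial>M) - (\<integral>x. f t0 x \<partial>M)) / (y - t0)) \<circ> X) \<longlonglongrightarrow> (\<integral>x. f' t0 x \<partial>M)"
  proof (rule Lim_transform_eventually)
    show "\<forall>\<^sub>F n in sequentially. (\<integral>x. S n x \<partial>M)
        = ((\<lambda>y. ((\<integral>x. f y x \<partial>M) - (\<integral>x. f t0 x \<partial>M)) / (y - t0)) \<circ> X) n"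
      using ev
    proof eventually_elim
      case (elim n)
      then have "(\<integral>x. S n x \<partial>M) = (\<integral>x. (f (X n) x - f t0 x) / (X n - t0) \<partial>M)"
        unfolding S_def by simp
      also have "\<dots> = ((\<integral>x. f (X n) x \<partial>M) - (\<integral>x. f t0 x \<partial>M)) / (X n - t0)"
        using Bochner_Integration.integral_diff[OF int[OF elim] int[OF t0]] by simp
      finally show ?case by simp
    qed
  qed
qed

text \<open>Strict convexity of \<open>x powr (1 + \<alpha>)\<close>: its graph lies strictly above
  the tangent at \<open>b\<close> away from \<open>b\<close>. The mean value theorem between
  \<open>a\<close> and \<open>b\<close> yields this, and rearranging gives the claim.\<close>

lemma strict_Young_powr:
  fixes a b \<alpha> :: real
  assumes "0 < a" "0 < b" "a \<noteq> b" "0 < \<alpha>"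
  shows "a * b powr \<alpha> < a powr (1 + \<alpha>) / (1 + \<alpha>) + \<alpha> / (1 + \<alpha>) * b powr (1 + \<alpha>)"
proof -
  have der: "((\<lambda>x. x powr (1 + \<alpha>)) has_real_derivative (1 + \<alpha>) * x powr \<alpha>) (at x)" if "x > 0" for x
    using that by (auto intro!: derivative_eq_intros)
  have b: "b powr (1 + \<alpha>) = b * b powr \<alpha>" using assms by (simp add: powr_add)
  have "(1 + \<alpha>) * (a - b) * b powr \<alpha> < a powr (1 + \<alpha>) - b powr (1 + \<alpha>)"
  proof (cases "a < b")
    case True
    then obtain \<xi> where \<xi>: "a < \<xi>" "\<xi> < b" "b powr (1 + \<alpha>) - a powr (1 + \<alpha>) = (b - a) * ((1 + \<alpha>) * \<xi> powr \<alpha>)"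
      using MVT2[OF True der] assms by auto
    have "(b - a) * ((1 + \<alpha>) * \<xi> powr \<alpha>) < (b - a) * ((1 + \<alpha>) * b powr \<alpha>)"
      using \<xi> True assms by (intro mult_strict_left_mono powr_less_mono2) auto
    then show ?thesis using \<xi>(3) by (simp add: algebra_simps)
  next
    case False
    then have "b < a" using assms by simp
    then obtain \<xi> where \<xi>: "b < \<xi>" "\<xi> < a" "a powr (1 + \<alpha>) - b powr (1 + \<alpha>) = (a - b) * ((1 + \<alpha>) * \<xi> powr \<alpha>)"
      using MVT2[OF \<open>b < a\<close> der] assms by auto
    have "(a - b) * ((1 + \<alpha>) * b powr \<alpha>) < (a - b) * ((1 + \<alpha>) * \<xi> powr \<alpha>)"
      using \<xi> \<open>b < a\<close> assms by (intro mult_strict_left_mono powr_less_mono2) auto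
    then show ?thesis using \<xi>(3) by (simp add: algebra_simps)
  qed
  then have "(1 + \<alpha>) * (a * b powr \<alpha>) < a powr (1 + \<alpha>) + \<alpha> * b powr (1 + \<alpha>)"
    unfolding b by (simp add: algebra_simps)
  then have "(1 + \<alpha>) * (a * b powr \<alpha>) / (1 + \<alpha>) < (a powr (1 + \<alpha>) + \<alpha> * b powr (1 + \<alpha>)) / (1 + \<alpha>)"
    using assms by (intro divide_strict_right_mono) auto
  then show ?thesis using assms by (simp add: add_divide_distrib)
qed

lemma set_integrable_powr_Ioi_1:
  fixes e :: real
  assumes "e < - 1"
  shows "set_integrable lborel {1<..} (\<lambda>x. x powr e)"
proof -
  have "(\<lambda>x. x powr e) integrable_on {1..}"
    using has_integral_powr_to_inf[OF assms, of 1] by (auto simp: integrable_on_def)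
  then have "(\<lambda>x. x powr e) absolutely_integrable_on {1..}"
    by (intro nonnegative_absolutely_integrable_1) auto
  then have "set_integrable lborel {1..} (\<lambda>x. x powr e)"
    unfolding set_integrable_def by (subst (asm) integrable_completion) auto
  then show ?thesis by (rule set_integrable_subset) auto
qed

locale robust_weight =
  fixes J :: "real \<Rightarrow> real" and \<alpha> :: real
  assumes J_zero: "\<And>s. s \<notin> {0<..<1} \<Longrightarrow> J s = 0"
    and A1: "weight_A1 J" and A2: "weight_A2 J" and A3: "weight_A3 J" and \<alpha>_pos: "\<alpha> > 0"
begin

section \<open>The weight and the parametric family \<open>ell_J\<close>\<close>

lemma J_pos: "0 < s \<Longrightarrow> s < 1 \<Longrightarrow> 0 < J s"
  using A3 unfolding weight_A3_def by auto

lemma J_nonneg: "0 \<le> J s"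
  using J_pos[of s] J_zero[of s] by (cases "s \<in> {0<..<1}") auto

lemma J_antimono: "0 < s \<Longrightarrow> s \<le> t \<Longrightarrow> t < 1 \<Longrightarrow> J t \<le> J s"
  using A1 unfolding weight_A1_def monotone_on_def by auto

lemma J_has_derivative: "0 < s \<Longrightarrow> s < 1 \<Longrightarrow> (J has_real_derivative deriv J s) (at s)"
  using A2 unfolding weight_A2_def bounded_derivs_upto3_def
  by (auto simp: DERIV_deriv_iff_real_differentiable dest!: spec[of _ 0])

lemma J_isCont: "0 < s \<Longrightarrow> s < 1 \<Longrightarrow> isCont J s"
  using J_has_derivative DERIV_isCont by blast

lemma J_bounded: "\<exists>B>0. \<forall>s. J s \<le> B"
proof -
  have "bounded (J ` {0<..<1})"
    using A2 unfolding weight_A2_def bounded_derivs_upto3_def by (auto dest: spec[of _ 0])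
  then obtain B where B: "\<And>s. s \<in> {0<..<1} \<Longrightarrow> norm (J s) \<le> B" unfolding bounded_iff by blast
  have "J s \<le> max B 1" for s using B[of s] J_zero[of s] by (cases "s \<in> {0<..<1}") auto
  then show ?thesis by (intro exI[of _ "max B 1"]) auto
qed

lemma L_bounded: "\<exists>K\<ge>0. \<forall>s. 0 < s \<longrightarrow> s < 1 \<longrightarrow> \<bar>deriv J s / J s * ln s\<bar> \<le> K"
proof -
  have "bounded ((\<lambda>s. deriv J s / J s * ln s) ` {0<..<1})"
    using A3 unfolding weight_A3_def bounded_derivs_upto3_def by (auto dest: spec[of _ 0])
  then obtain K where K: "\<And>s. s \<in> {0<..<1} \<Longrightarrow> norm (deriv J s / J s * ln s) \<le> K"
    unfolding bounded_iff by blast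
  have "0 \<le> norm (deriv J (1/2) / J (1/2) * ln (1/2))" by simp
  also have "\<dots> \<le> K" by (rule K) simp
  finally show ?thesis using K by (intro exI[of _ K]) auto
qed

lemma J_measurable [measurable]: "J \<in> borel_measurable borel"
proof -
  have "(\<lambda>x. indicator {0<..<1} x *\<^sub>R J x) \<in> borel_measurable borel"
    using A1 unfolding weight_A1_def by (intro borel_measurable_continuous_on_indicator) auto
  also have "(\<lambda>x. indicator {0<..<1} x *\<^sub>R J x) = J" using J_zero by (auto simp: indicator_def fun_eq_iff)
  finally show ?thesis .
qed

lemma ell_J_measurable [measurable]: "(\<lambda>x. ell_J J g x) \<in> borel_measurable borel"
  unfolding ell_J_def ell_def by measurable

text \<open>For \<open>0 < x \<le> 1\<close> the argument of \<open>J\<close> is at least 1, where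
  \<open>J\<close> vanishes; at \<open>x = 0\<close> the convention \<open>0 powr e = 0\<close>
  applies.\<close>

lemma ell_J_eq_0: 
  assumes "0 \<le> x" "x \<le> 1" "0 < g" 
  shows "ell_J J g x = 0"
proof (cases "x = 0")
  case False
  then have "1 powr (- 1 / g) \<le> x powr (- 1 / g)" using assms by (intro powr_mono2') auto
  then show ?thesis unfolding ell_J_def by (simp add: J_zero)
qed (simp add: ell_J_def ell_def)

lemma powr_in_unit: "1 < x \<Longrightarrow> 0 < g \<Longrightarrow> 0 < x powr (- 1 / g) \<and> x powr (- 1 / g) < (1::real)"
  using powr_less_mono2_neg[of "-1/g" 1 x] by simp

lemma ell_J_pos: "1 < x \<Longrightarrow> 0 < g \<Longrightarrow> 0 < ell_J J g x"
  unfolding ell_J_def ell_def using powr_in_unit[of x g] by (simp add: J_pos)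

lemma ell_J_nonneg: "0 < g \<Longrightarrow> 0 \<le> ell_J J g x"
  unfolding ell_J_def ell_def by (simp add: J_nonneg)

lemma ell_J_le:
  assumes "\<And>s. J s \<le> B" "0 < g"
  shows "ell_J J g x \<le> B / g * x powr (- 1 - 1 / g)"
proof -
  have "ell_J J g x \<le> B * (1 / g * x powr (- 1 - 1 / g))"
    unfolding ell_J_def ell_def using assms J_nonneg by (intro mult_right_mono) auto
  then show ?thesis by simp
qed

lemma ell_J_powr_bounded:
  assumes "0 < g" "0 < p"
  shows "\<exists>C. \<forall>x\<ge>0. ell_J J g x powr p \<le> C"
proof -
  obtain B where B: "B > 0" "\<And>s. J s \<le> B" using J_bounded by blast
  have "ell_J J g x \<le> B / g" if "0 \<le> x" for x
  proof (cases "x \<le> 1")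
    case True
    then show ?thesis using ell_J_eq_0 that assms B by simp
  next
    case False
    have "- 1 - 1 / g \<le> 0" using assms by (simp add: field_simps)
    then have "x powr (- 1 - 1 / g) \<le> 1 powr (- 1 - 1 / g)" using False by (intro powr_mono2') auto
    then have "B / g * x powr (- 1 - 1 / g) \<le> B / g * 1" using B assms by (intro mult_left_mono) auto
    then show ?thesis using ell_J_le[OF B(2) assms(1), of x] by simp
  qed
  then have "ell_J J g x powr p \<le> (B / g) powr p" if "0 \<le> x" for x
    using that ell_J_nonneg assms by (intro powr_mono2) auto
  then show ?thesis by blast
qed

text \<open>The derivative of \<open>ln (ell_J J g x)\<close> in \<open>g\<close>. With
  \<open>ln u = - ln x / g\<close> it is written so that the function bounded by [A3] appears as a
  factor.\<close>

definition score :: "real \<Rightarrow> real \<Rightarrow> real" where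
  "score g x = (let u = x powr (- 1 / g) in - (1 / g) * (1 + ln u + u * (deriv J u / J u * ln u)))"

lemma ell_J_has_derivative:
  assumes "1 < x" "0 < g"
  shows "((\<lambda>g. ell_J J g x) has_real_derivative ell_J J g x * score g x) (at g)"
proof -
  define u where "u = x powr (- 1 / g)"
  have u: "0 < u" "u < 1" using powr_in_unit[OF assms] by (auto simp: u_def)
  have lnu: "ln u = - ln x / g" unfolding u_def using assms by (simp add: ln_powr)
  have 1: "((\<lambda>g. x powr (- 1 / g)) has_real_derivative u * (ln x / g\<^sup>2)) (at g)"
    using assms unfolding u_def powr_def by (auto intro!: derivative_eq_intros simp: power2_eq_square)
  have 2: "((\<lambda>g. J (x powr (- 1 / g))) has_real_derivative deriv J u * (u * (ln x / g\<^sup>2))) (at g)"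
    using DERIV_chain2[of J "deriv J u" "\<lambda>g. x powr (- 1 / g)" g, OF _ 1] J_has_derivative[OF u] by (simp add: u_def)
  have 3: "((\<lambda>g. ell g x) has_real_derivative ell g x * (- 1 / g + ln x / g\<^sup>2)) (at g)"
  proof -
    have "((\<lambda>g. 1 / g) has_real_derivative - (1 / g\<^sup>2)) (at g)"
      using assms by (auto intro!: derivative_eq_intros simp: power2_eq_square)
    moreover have "((\<lambda>g. x powr (- 1 - 1 / g)) has_real_derivative x powr (- 1 - 1 / g) * (ln x / g\<^sup>2)) (at g)"
      using assms unfolding powr_def by (auto intro!: derivative_eq_intros simp: power2_eq_square)
    ultimately have "((\<lambda>g. ell g x) has_real_derivative
        - (1 / g\<^sup>2) * x powr (- 1 - 1 / g) + x powr (- 1 - 1 / g) * (ln x / g\<^sup>2) * (1 / g)) (at g)"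
      unfolding ell_def by (rule DERIV_mult)
    also have "- (1 / g\<^sup>2) * x powr (- 1 - 1 / g) + x powr (- 1 - 1 / g) * (ln x / g\<^sup>2) * (1 / g)
        = ell g x * (- 1 / g + ln x / g\<^sup>2)"
      using assms unfolding ell_def by (simp add: power2_eq_square field_simps)
    finally show ?thesis .
  qed
  have "((\<lambda>g. ell_J J g x) has_real_derivative
      deriv J u * (u * (ln x / g\<^sup>2)) * ell g x + ell g x * (- 1 / g + ln x / g\<^sup>2) * J u) (at g)"
    unfolding ell_J_def using DERIV_mult[OF 2 3] by (simp add: u_def)
  also have "deriv J u * (u * (ln x / g\<^sup>2)) * ell g x + ell g x * (- 1 / g + ln x / g\<^sup>2) * J u
     = ell_J J g x * score g x"
    using J_pos[OF u] assms unfolding ell_J_def score_def Let_def u_def[symmetric] lnu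
    by (simp add: power2_eq_square field_simps)
  finally show ?thesis .
qed

lemma ell_J_powr_has_derivative:
  assumes "1 < x" "0 < g"
  shows "((\<lambda>g. ell_J J g x powr p) has_real_derivative p * ell_J J g x powr p * score g x) (at g)"
proof -
  have pos: "ell_J J g x > 0" by (rule ell_J_pos[OF assms])
  have "((\<lambda>g. ell_J J g x powr p) has_real_derivative p * ell_J J g x powr (p - 1) * (ell_J J g x * score g x)) (at g)"
    by (rule DERIV_chain2[OF has_real_derivative_powr[OF pos] ell_J_has_derivative[OF assms]])
  also have "p * ell_J J g x powr (p - 1) * (ell_J J g x * score g x) = p * ell_J J g x powr p * score g x"
    using pos by (simp add: powr_diff)
  finally show ?thesis .
qed

text \<open>For \<open>x \<le> 1\<close> the function vanishes identically on the open half-line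
  \<open>g > 0\<close>, so tied observations do not disturb differentiability.\<close>

lemma ell_J_powr_differentiable:
  assumes "0 \<le> x" "0 < g"
  shows "(\<lambda>g. ell_J J g x powr p) differentiable (at g)"
proof (cases "1 < x")
  case True
  then show ?thesis using ell_J_powr_has_derivative[OF True assms(2)] real_differentiable_def by blast
next
  case False
  have "((\<lambda>g. ell_J J g x powr p) has_real_derivative 0) (at g)"
  proof (rule has_field_derivative_transform_within_open[of "\<lambda>_. 0" _ _ "{0<..}"])
    show "0 = ell_J J h x powr p" if "h \<in> {0<..}" for h using that False assms ell_J_eq_0 by simp
  qed (use assms in auto)
  then show ?thesis using real_differentiable_def by blast
qed

text \<open>Since \<open>u < 1\<close>, assumption [A3] bounds the term with \<open>deriv J\<close>;
  what is left grows only like \<open>ln x\<close>.\<close>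

lemma score_bounded:
  "\<exists>K\<ge>0. \<forall>g x. 1 < x \<longrightarrow> 0 < g \<longrightarrow> \<bar>score g x\<bar> \<le> 1 / g * (1 + K + ln x / g)"
proof -
  obtain K where K: "K \<ge> 0" "\<And>s. 0 < s \<Longrightarrow> s < 1 \<Longrightarrow> \<bar>deriv J s / J s * ln s\<bar> \<le> K" using L_bounded by blast
  have "\<bar>score g x\<bar> \<le> 1 / g * (1 + K + ln x / g)" if "1 < x" "0 < g" for g x
  proof -
    define u where "u = x powr (- 1 / g)"
    have u: "0 < u" "u < 1" using powr_in_unit[OF that] by (auto simp: u_def)
    have lnu: "ln u = - ln x / g" unfolding u_def using that by (simp add: ln_powr)
    have "\<bar>u * (deriv J u / J u * ln u)\<bar> \<le> 1 * K"
      unfolding abs_mult[of u] using u K by (intro mult_mono) auto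
    moreover have "\<bar>ln u\<bar> \<le> ln x / g" unfolding lnu using that by (simp add: abs_if)
    ultimately have "\<bar>1 + ln u + u * (deriv J u / J u * ln u)\<bar> \<le> 1 + K + ln x / g" by linarith
    then have "1 / g * \<bar>1 + ln u + u * (deriv J u / J u * ln u)\<bar> \<le> 1 / g * (1 + K + ln x / g)"
      using that by (intro mult_left_mono) auto
    then show ?thesis using that unfolding score_def Let_def u_def[symmetric] abs_mult by simp
  qed
  then show ?thesis using K(1) by blast
qed

lemma ell_J_powr_integrable:
  assumes "0 < g" 
  shows "set_integrable lborel {1<..} (\<lambda>x. ell_J J g x powr (1 + \<alpha>))"
proof -
  obtain B where B: "B > 0" "\<And>s. J s \<le> B" using J_bounded by blast
  let ?e = "(- 1 - 1 / g) * (1 + \<alpha>)"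
  have "?e < - 1" using assms \<alpha>_pos by (simp add: field_simps add_pos_pos)
  then have 1: "set_integrable lborel {1<..} (\<lambda>x. (B / g) powr (1 + \<alpha>) * x powr ?e)"
    by (intro set_integrable_mult_right set_integrable_powr_Ioi_1)
  show ?thesis
  proof (rule set_integrable_bound[OF 1])
    show "AE x in lborel. x \<in> {1<..} \<longrightarrow> norm (ell_J J g x powr (1 + \<alpha>)) \<le> norm ((B / g) powr (1 + \<alpha>) * x powr ?e)"
    proof (intro AE_I2 impI)
      fix x :: real assume x: "x \<in> {1<..}"
      have "ell_J J g x powr (1 + \<alpha>) \<le> (B / g * x powr (- 1 - 1 / g)) powr (1 + \<alpha>)"
        using ell_J_le[OF B(2) assms] ell_J_nonneg[OF assms] \<alpha>_pos by (intro powr_mono2) auto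
      also have "\<dots> = (B / g) powr (1 + \<alpha>) * x powr ?e"
        using B assms x by (subst powr_mult) (auto simp: powr_powr)
      finally show "norm (ell_J J g x powr (1 + \<alpha>)) \<le> norm ((B / g) powr (1 + \<alpha>) * x powr ?e)" by simp
    qed
  qed (auto simp: set_borel_measurable_def)
qed

text \<open>Differentiation under the integral, with the parameter confined to
  \<open>(g / 2, 2 * g)\<close> so that a single power of \<open>x\<close> dominates all
  derivatives.\<close>

lemma ell_J_powr_integral_has_derivative:
  assumes "0 < g"
  shows "((\<lambda>g. LBINT x:{1<..}. ell_J J g x powr (1 + \<alpha>)) has_real_derivative
      (LBINT x:{1<..}. deriv (\<lambda>g. ell_J J g x powr (1 + \<alpha>)) g)) (at g)"
proof -
  define p where "p = 1 + \<alpha>"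
  have p: "p > 1" using \<alpha>_pos by (simp add: p_def)
  obtain B where B: "B > 0" "\<And>s. J s \<le> B" using J_bounded by blast
  obtain K where K: "K \<ge> 0" "\<And>g x. 1 < x \<Longrightarrow> 0 < g \<Longrightarrow> \<bar>score g x\<bar> \<le> 1 / g * (1 + K + ln x / g)"
    using score_bounded by blast
  define c d where "c = g / 2" and "d = 2 * g"
  have cd: "0 < c" "c < g" "g < d" using assms by (auto simp: c_def d_def)
  \<comment> \<open>The power of the density is at most a constant times
    \<open>x powr (- p - p / d)\<close>. The surplus \<open>- p / d\<close> pays for the logarithm
    in the score, as \<open>ln x \<le> x powr (p / d) * (d / p)\<close>. This leaves
    \<open>x powr (- p)\<close>, integrable since \<open>p > 1\<close>; \<open>C\<close> collects
    the constants.\<close>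
  define C where "C = p * (B / c) powr p * (1 / c * (1 + K + d / (p * c)))"
  have C0: "C \<ge> 0" using cd B K p unfolding C_def by (intro mult_nonneg_nonneg add_nonneg_nonneg) auto
  define D where "D t x = p * ell_J J t x powr p * score t x" for t x
  have D_bound: "\<bar>D t x\<bar> \<le> C * x powr (- p)" if x: "1 < x" and t: "t \<in> {c<..<d}" for t x
  proof -
    have t0: "t > 0" using t cd by auto
    have e: "x powr (- 1 - 1 / t) \<le> x powr (- 1 - 1 / d)"
      using x t t0 cd by (intro powr_mono) (auto simp: frac_le)
    have "ell_J J t x \<le> B / t * x powr (- 1 - 1 / t)" by (rule ell_J_le[OF B(2) t0])
    also have "\<dots> \<le> B / c * x powr (- 1 - 1 / d)"
      using e B t cd t0 by (intro mult_mono) (auto intro!: divide_left_mono)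
    finally have "ell_J J t x powr p \<le> (B / c * x powr (- 1 - 1 / d)) powr p"
      using ell_J_nonneg[OF t0] p by (intro powr_mono2) auto
    also have "\<dots> = (B / c) powr p * x powr ((- 1 - 1 / d) * p)" using B cd x by (subst powr_mult) (auto simp: powr_powr)
    also have "(- 1 - 1 / d) * p = - p - p / d" by (simp add: algebra_simps)
    finally have 1: "ell_J J t x powr p \<le> (B / c) powr p * x powr (- p - p / d)" .
    have pd: "p / d > 0" using p cd by simp
    have "ln x \<le> x powr (p / d) / (p / d)" using x pd by (intro ln_powr_bound) auto
    then have "ln x \<le> x powr (p / d) * (d / p)" by (simp add: field_simps)
    have "\<bar>score t x\<bar> \<le> 1 / t * (1 + K + ln x / t)" by (rule K(2)[OF x t0])
    also have "\<dots> \<le> 1 / c * (1 + K + ln x / c)"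
      using t t0 cd x K by (intro mult_mono add_mono order.refl divide_left_mono) (auto intro!: add_nonneg_nonneg)
    also have "\<dots> \<le> 1 / c * ((1 + K) * x powr (p / d) + x powr (p / d) * (d / p) / c)"
    proof (intro mult_left_mono add_mono divide_right_mono)
      have "x powr (p / d) \<ge> 1" using x pd by (intro ge_one_powr_ge_zero) auto
      then show "1 + K \<le> (1 + K) * x powr (p / d)" using K mult_left_mono[of 1 "x powr (p / d)" "1 + K"] by simp
    qed (use cd \<open>ln x \<le> x powr (p / d) * (d / p)\<close> in auto)
    also have "\<dots> = 1 / c * (1 + K + d / (p * c)) * x powr (p / d)" by (simp add: field_simps)
    finally have 2: "\<bar>score t x\<bar> \<le> 1 / c * (1 + K + d / (p * c)) * x powr (p / d)" .
    have "\<bar>D t x\<bar> = p * (ell_J J t x powr p * \<bar>score t x\<bar>)" unfolding D_def using p by (simp add: abs_mult)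
    also have "\<dots> \<le> p * ((B / c) powr p * x powr (- p - p / d) * (1 / c * (1 + K + d / (p * c)) * x powr (p / d)))"
      using p by (intro mult_left_mono mult_mono 1 2) auto
    also have "\<dots> = C * (x powr (- p - p / d) * x powr (p / d))" unfolding C_def by (simp add: algebra_simps)
    also have "x powr (- p - p / d) * x powr (p / d) = x powr (- p)" by (simp flip: powr_add)
    finally show ?thesis .
  qed
  have "((\<lambda>t. \<integral>x. indicator {1<..} x *\<^sub>R ell_J J t x powr p \<partial>lborel) has_real_derivative
      (\<integral>x. indicator {1<..} x *\<^sub>R D g x \<partial>lborel)) (at g)"
  proof (rule has_real_derivative_lebesgue_integral[where a=c and b=d and w="\<lambda>x. indicator {1<..} x *\<^sub>R (C * x powr (- p))"])
    show "integrable lborel (\<lambda>x. indicator {1<..} x *\<^sub>R (C * x powr (- p)))"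
      using set_integrable_mult_right[OF set_integrable_powr_Ioi_1[of "- p"], of C] p
      unfolding set_integrable_def by simp
    show "integrable lborel (\<lambda>x. indicator {1<..} x *\<^sub>R ell_J J t x powr p)" if "t \<in> {c<..<d}" for t
      using ell_J_powr_integrable[of t] that cd unfolding set_integrable_def p_def by simp
    show "((\<lambda>t. indicator {1<..} x *\<^sub>R ell_J J t x powr p) has_real_derivative indicator {1<..} x *\<^sub>R D t x) (at t)"
      if "t \<in> {c<..<d}" for t x
      using ell_J_powr_has_derivative[of x t p] that cd by (cases "1 < x") (auto simp: D_def)
    show "\<bar>indicator {1<..} x *\<^sub>R D t x\<bar> \<le> indicator {1<..} x *\<^sub>R (C * x powr (- p))" if "t \<in> {c<..<d}" for t x
      using D_bound[OF _ that, of x] by (auto simp: indicator_def)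
  qed (use cd in auto)
  moreover have "(LBINT x:{1<..}. deriv (\<lambda>g. ell_J J g x powr p) g) = (\<integral>x. indicator {1<..} x *\<^sub>R D g x \<partial>lborel)"
    unfolding set_lebesgue_integral_def D_def
    by (intro Bochner_Integration.integral_cong refl)
      (auto simp: indicator_def DERIV_imp_deriv[OF ell_J_powr_has_derivative[OF _ assms]])
  ultimately show ?thesis unfolding set_lebesgue_integral_def p_def by simp
qed

text \<open>The ratio of the two densities tends to \<open>0\<close>, because \<open>J\<close> is bounded and stays away from \<open>0\<close>
  near \<open>0\<close>. This makes the Young inequality strict on a set of positive measure.\<close>

lemma ell_J_neq_eventually:
  assumes "0 < g" "g < h"
  shows "\<forall>\<^sub>F x in at_top. ell_J J g x \<noteq> ell_J J h x"
proof -
  obtain B where B: "B > 0" "\<And>s. J s \<le> B" using J_bounded by blast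
  define e where "e = 1 / g - 1 / h"
  have e: "e > 0" using assms by (simp add: e_def field_simps)
  have "((\<lambda>x. B * h / g * x powr (- e)) \<longlongrightarrow> B * h / g * 0) at_top"
    using e by (intro tendsto_mult tendsto_const tendsto_neg_powr filterlim_ident) auto
  then have 1: "\<forall>\<^sub>F x in at_top. B * h / g * x powr (- e) < J (1 / 2)"
    using J_pos[of "1/2"] by (intro order_tendstoD) auto
  have "((\<lambda>x. x powr (- 1 / h)) \<longlongrightarrow> 0) at_top"
    using assms by (intro tendsto_neg_powr filterlim_ident) auto
  then have 2: "\<forall>\<^sub>F x in at_top. x powr (- 1 / h) < (1 / 2 :: real)" by (intro order_tendstoD) auto
  show ?thesis
    using 1 2 eventually_gt_at_top[of 1]
  proof eventually_elim
    case (elim x)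
    show ?case
    proof
      assume eq: "ell_J J g x = ell_J J h x"
      have "J (1 / 2) \<le> J (x powr (- 1 / h))" using elim assms by (intro J_antimono) auto
      moreover have "J (x powr (- 1 / h)) = J (x powr (- 1 / g)) * (h / g * x powr (- e))"
      proof -
        have "x powr (- 1 - 1 / g) = x powr (- 1 - 1 / h) * x powr (- e)"
          unfolding e_def by (simp flip: powr_add)
        then have "J (x powr (- 1 / g)) * (1 / g * (x powr (- 1 - 1 / h) * x powr (- e)))
            = J (x powr (- 1 / h)) * (1 / h * x powr (- 1 - 1 / h))"
          using eq unfolding ell_J_def ell_def by simp
        then show ?thesis using elim assms by (simp add: field_simps)
      qed
      moreover have "J (x powr (- 1 / g)) * (h / g * x powr (- e)) \<le> B * (h / g * x powr (- e))"
        using B assms by (intro mult_right_mono) auto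
      ultimately show False using elim by simp
    qed
  qed
qed

section \<open>The limit of the objective and its strict maximum\<close>

text \<open>Here \<open>h\<close> plays the role of the true tail index. The first integral runs
  over the rank fraction \<open>s = i / k\<close>, the form in which the weighted rank average
  converges.\<close>

definition limit_objective :: "real \<Rightarrow> real \<Rightarrow> real" where
  "limit_objective h g = (LBINT s:{0<..<1}. J s * ell_J J g (s powr (- h)) powr \<alpha>)
     - \<alpha> / (\<alpha> + 1) * (LBINT x:{1<..}. ell_J J g x powr (1 + \<alpha>))"

lemma J_ell_J_integrable:
  assumes "0 < g"
  shows "set_integrable lborel {0<..<1} (\<lambda>s. J s * ell_J J g (s powr (- h)) powr \<alpha>)"
proof -
  obtain B where B: "B > 0" "\<And>s. J s \<le> B" using J_bounded by blast
  obtain C where C: "\<And>x. 0 \<le> x \<Longrightarrow> ell_J J g x powr \<alpha> \<le> C" using ell_J_powr_bounded[OF assms \<alpha>_pos] by blast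
  have 1: "set_integrable lborel {0<..<1::real} (\<lambda>s. B * C)" 
    unfolding set_integrable_def by (auto intro!: integrable_real_mult_indicator)
  show ?thesis
  proof (rule set_integrable_bound[OF 1])
    show "AE s in lborel. s \<in> {0<..<1} \<longrightarrow> norm (J s * ell_J J g (s powr (- h)) powr \<alpha>) \<le> norm (B * C)"
    proof (intro AE_I2 impI)
      fix s :: real
      have "J s * ell_J J g (s powr (- h)) powr \<alpha> \<le> B * C" using B C J_nonneg by (intro mult_mono) auto
      then show "norm (J s * ell_J J g (s powr (- h)) powr \<alpha>) \<le> norm (B * C)" using J_nonneg[of s] by simp
    qed
  qed (auto simp: set_borel_measurable_def)
qed

text \<open>The substitution \<open>s = x powr (- 1 / h)\<close> turns \<open>J s ds\<close> into
  \<open>ell_J J h x dx\<close>: if \<open>s\<close> has density \<open>J\<close>, then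
  \<open>s powr (- h)\<close> has density \<open>ell_J J h\<close>.\<close>

lemma J_ell_J_substitution:
  assumes "0 < g" "0 < h"
  shows "set_integrable lborel {1<..} (\<lambda>x. ell_J J h x * ell_J J g x powr \<alpha>)"
    and "(LBINT s:{0<..<1}. J s * ell_J J g (s powr (- h)) powr \<alpha>)
      = (LBINT x:{1<..}. ell_J J h x * ell_J J g x powr \<alpha>)"
proof -
  define f where "f s = J s * ell_J J g (s powr (- h)) powr \<alpha>" for s
  define u where "u x = x powr (- 1 / h)" for x :: real
  define u' where "u' x = - (1 / h) * x powr (- 1 - 1 / h)" for x :: real
  have img: "u ` {1<..} = {0<..<1}"
  proof safe
    fix s :: real assume s: "s \<in> {0<..<1}"
    have "1 powr (- h) < s powr (- h)" using s assms by (intro powr_less_mono2_neg) auto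
    moreover have "u (s powr (- h)) = s" using s assms by (simp add: u_def powr_powr)
    ultimately show "s \<in> u ` {1<..}" by (intro image_eqI[of _ _ "s powr (- h)"]) auto
  qed (use powr_in_unit assms in \<open>auto simp: u_def\<close>)
  have der: "(u has_field_derivative u' x) (at x within {1<..})" if "x \<in> {1<..}" for x
  proof -
    have e: "- 1 / h - 1 = - 1 - 1 / h" by simp
    have "(u has_field_derivative (- 1 / h) * x powr (- 1 / h - 1)) (at x)"
      unfolding u_def[abs_def] using that by (intro has_real_derivative_powr) simp
    also have "(- 1 / h) * x powr (- 1 / h - 1) = u' x" unfolding u'_def e by simp
    finally show ?thesis by (rule has_field_derivative_at_within)
  qed
  have inj: "inj_on u {1<..}"
  proof (rule inj_onI)
    fix x y :: real assume "x \<in> {1<..}" "y \<in> {1<..}" "u x = u y"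
    then have "u x powr (- h) = u y powr (- h)" by simp
    with \<open>x \<in> _\<close> \<open>y \<in> _\<close> assms show "x = y" by (simp add: u_def powr_powr)
  qed
  have int01: "set_integrable lborel {0<..<1} f" unfolding f_def by (rule J_ell_J_integrable[OF assms(1)])
  then have abs01: "f absolutely_integrable_on {0<..<1}"
    unfolding set_integrable_def by (subst integrable_completion) auto
  have eq: "\<bar>u' x\<bar> * f (u x) = ell_J J h x * ell_J J g x powr \<alpha>" if "x \<in> {1<..}" for x
    using that assms by (simp add: u'_def u_def f_def ell_J_def ell_def powr_powr abs_mult)
  have "(\<lambda>x. \<bar>u' x\<bar> * f (u x)) absolutely_integrable_on {1<..} \<and>
     integral {1<..} (\<lambda>x. \<bar>u' x\<bar> * f (u x)) = integral {0<..<1} f"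
    using has_absolute_integral_change_of_variables_1'[OF _ der inj, of f "integral {0<..<1} f"] abs01 img by simp
  moreover have "(\<lambda>x. \<bar>u' x\<bar> * f (u x)) absolutely_integrable_on {1<..} \<longleftrightarrow>
      (\<lambda>x. ell_J J h x * ell_J J g x powr \<alpha>) absolutely_integrable_on {1<..}"
    by (intro set_integrable_cong) (auto simp: eq simp del: greaterThan_iff)
  moreover have "integral {1<..} (\<lambda>x. \<bar>u' x\<bar> * f (u x)) = integral {1<..} (\<lambda>x. ell_J J h x * ell_J J g x powr \<alpha>)"
    by (intro Henstock_Kurzweil_Integration.integral_cong eq)
  ultimately have A: "(\<lambda>x. ell_J J h x * ell_J J g x powr \<alpha>) absolutely_integrable_on {1<..}"
     "integral {1<..} (\<lambda>x. ell_J J h x * ell_J J g x powr \<alpha>) = integral {0<..<1} f" by auto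
  show B: "set_integrable lborel {1<..} (\<lambda>x. ell_J J h x * ell_J J g x powr \<alpha>)"
    using A(1) unfolding set_integrable_def by (subst (asm) integrable_completion) auto
  show "(LBINT s:{0<..<1}. J s * ell_J J g (s powr (- h)) powr \<alpha>)
      = (LBINT x:{1<..}. ell_J J h x * ell_J J g x powr \<alpha>)"
    using A(2) set_borel_integral_eq_integral(2)[OF B] set_borel_integral_eq_integral(2)[OF int01]
    unfolding f_def by simp
qed

text \<open>The difference of the two values is the integral of the pointwise deficit
  \<open>d\<close> in Young's inequality between \<open>ell_J J h x\<close> and
  \<open>ell_J J g x\<close>.\<close>

lemma limit_objective_less:
  assumes "0 < g" "0 < h" "g \<noteq> h"
  shows "limit_objective h g < limit_objective h h"
proof -
  let ?P = "\<lambda>g x. ell_J J g x powr (1 + \<alpha>)"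
  let ?M = "\<lambda>x. ell_J J h x * ell_J J g x powr \<alpha>"
  define d where "d x = 1 / (1 + \<alpha>) * ?P h x + \<alpha> / (1 + \<alpha>) * ?P g x - ?M x" for x
  note int = ell_J_powr_integrable[OF assms(1)] ell_J_powr_integrable[OF assms(2)] J_ell_J_substitution(1)[OF assms(1,2)]
  have d_int: "set_integrable lborel {1<..} d" unfolding d_def
    by (intro set_integral_diff set_integral_add set_integrable_mult_right int)
  have d_eq: "(LBINT x:{1<..}. d x) = 1 / (1 + \<alpha>) * (LBINT x:{1<..}. ?P h x) + \<alpha> / (1 + \<alpha>) * (LBINT x:{1<..}. ?P g x) - (LBINT x:{1<..}. ?M x)"
    unfolding d_def
    by (simp only: set_integral_diff(2)[OF set_integral_add(1)[OF set_integrable_mult_right[OF int(2)] set_integrable_mult_right[OF int(1)]] int(3)]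
        set_integral_add(2)[OF set_integrable_mult_right[OF int(2)] set_integrable_mult_right[OF int(1)]] set_integral_mult_right)
  have d_pos: "d x > 0" if "1 < x" "ell_J J h x \<noteq> ell_J J g x" for x
    using strict_Young_powr[OF ell_J_pos[OF that(1) assms(2)] ell_J_pos[OF that(1) assms(1)] that(2) \<alpha>_pos]
    unfolding d_def by simp
  have d_nonneg: "d x \<ge> 0" if "1 < x" for x
  proof (cases "ell_J J h x = ell_J J g x")
    case True
    have "?M x = ?P g x" using ell_J_pos[OF that assms(1)] True by (simp add: powr_add)
    then have "d x = (1 / (1 + \<alpha>) + \<alpha> / (1 + \<alpha>)) * ?P g x - ?P g x"
      unfolding d_def True by (simp only: distrib_right)
    also have "1 / (1 + \<alpha>) + \<alpha> / (1 + \<alpha>) = 1" using \<alpha>_pos by (simp flip: add_divide_distrib)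
    finally show ?thesis by simp
  qed (use d_pos[OF that] in auto)
  have "\<forall>\<^sub>F x in at_top. ell_J J h x \<noteq> ell_J J g x"
    using ell_J_neq_eventually[of g h] ell_J_neq_eventually[of h g] assms
    by (cases "g < h") (auto elim: eventually_mono)
  then have "\<forall>\<^sub>F x in at_top. ell_J J h x \<noteq> ell_J J g x \<and> 1 < x"
    using eventually_gt_at_top[of 1] by eventually_elim auto
  then obtain R where R: "\<And>x. x \<ge> R \<Longrightarrow> ell_J J h x \<noteq> ell_J J g x \<and> 1 < x"
    by (auto simp: eventually_at_top_linorder)
  \<comment> \<open>A vanishing integral would make the nonnegative \<open>d\<close> zero almost
    everywhere, but \<open>d\<close> is positive on \<open>{R..R + 1}\<close>, which has measure
    1.\<close>
  have "(LBINT x:{1<..}. d x) \<noteq> 0"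
  proof
    assume 0: "(LBINT x:{1<..}. d x) = 0"
    have "AE x in lborel. indicator {1<..} x *\<^sub>R d x = 0"
      using 0 d_int d_nonneg unfolding set_lebesgue_integral_def set_integrable_def
      by (subst (asm) integral_nonneg_eq_0_iff_AE) (auto simp: indicator_def)
    then have "AE x in lborel. x \<notin> {R..R + 1}"
    proof (rule AE_mp, intro AE_I2 impI)
      fix x assume 0: "indicator {1<..} x *\<^sub>R d x = 0"
      show "x \<notin> {R..R + 1}" using R[of x] d_pos[of x] 0 by (auto simp: indicator_def)
    qed
    then have "emeasure lborel {x \<in> space lborel. \<not> x \<notin> {R..R + 1}} = 0"
      by (subst (asm) AE_iff_measurable[OF _ refl]) auto
    also have "{x \<in> space lborel. \<not> x \<notin> {R..R + 1}} = {R..R + 1}" by auto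
    finally show False by simp
  qed
  moreover have "(LBINT x:{1<..}. d x) \<ge> 0"
    unfolding set_lebesgue_integral_def using d_nonneg by (intro integral_nonneg_AE) (auto simp: indicator_def)
  ultimately have pos: "(LBINT x:{1<..}. d x) > 0" by simp
  have hh: "(LBINT x:{1<..}. ell_J J h x * ell_J J h x powr \<alpha>) = (LBINT x:{1<..}. ?P h x)"
  proof (rule set_lebesgue_integral_cong; clarsimp)
    fix x :: real assume "1 < x"
    then show "ell_J J h x * ell_J J h x powr \<alpha> = ell_J J h x powr (1 + \<alpha>)"
      using ell_J_pos[OF _ assms(2), of x] by (simp add: powr_add)
  qed
  have "limit_objective h h = (LBINT x:{1<..}. ?P h x) - \<alpha> / (\<alpha> + 1) * (LBINT x:{1<..}. ?P h x)"
    unfolding limit_objective_def J_ell_J_substitution(2)[OF assms(2,2)] hh ..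
  also have "\<dots> = 1 / (1 + \<alpha>) * (LBINT x:{1<..}. ?P h x)" using \<alpha>_pos by (simp add: field_simps)
  finally show ?thesis
    using pos unfolding d_eq limit_objective_def J_ell_J_substitution(2)[OF assms(1,2)] by (simp add: add.commute)
qed

end

subsection \<open>Maximisers of the empirical objective\<close>

text \<open>The smallest maximiser is measurable: it is at most \<open>c\<close> exactly when the
  maximum over \<open>{a..c}\<close> equals the maximum over \<open>{a..b}\<close>, and these maxima
  are countable suprema.\<close>

lemma measurable_argmax:
  fixes f :: "'a \<Rightarrow> real \<Rightarrow> real"
  assumes ab: "a \<le> b"
    and meas: "\<And>t. t \<in> {a..b} \<Longrightarrow> (\<lambda>\<omega>. f \<omega> t) \<in> borel_measurable M"
    and cont: "\<And>\<omega>. \<omega> \<in> space M \<Longrightarrow> continuous_on {a..b} (f \<omega>)"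
  shows "\<exists>Z\<in>borel_measurable M. \<forall>\<omega>\<in>space M. Z \<omega> \<in> {a..b} \<and> (\<forall>t\<in>{a..b}. f \<omega> t \<le> f \<omega> (Z \<omega>))"
proof -
  \<comment> \<open>Clamping maps all rationals into \<open>{a..c}\<close>, so that the same
    countable index set serves every \<open>c\<close>; the endpoints are reached even when they are
    irrational.\<close>
  define S where "S c \<omega> = (SUP q\<in>\<rat>. f \<omega> (max a (min c q)))" for c \<omega>
  have bdd: "bdd_above ((\<lambda>q. f \<omega> (max a (min c q))) ` \<rat>)" if c: "c \<in> {a..b}" and \<omega>: "\<omega> \<in> space M" for c \<omega>
  proof -
    have "bdd_above (f \<omega> ` {a..b})"
      by (intro bounded_imp_bdd_above compact_imp_bounded compact_continuous_image cont \<omega>) auto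
    then show ?thesis by (rule bdd_above_mono) (use c in auto)
  qed
  have S_meas: "S c \<in> borel_measurable M" if "c \<in> {a..b}" for c
    unfolding S_def[abs_def] by (intro borel_measurable_cSUP countable_rat meas bdd that) (use that in auto)
  have S_ge: "f \<omega> t \<le> S c \<omega>" if c: "c \<in> {a..b}" and \<omega>: "\<omega> \<in> space M" and t: "t \<in> {a..c}" for c t \<omega>
  proof -
    have "continuous_on UNIV (\<lambda>q. f \<omega> (max a (min c q)))"
      by (rule continuous_on_compose2[OF cont[OF \<omega>]]) (use c in \<open>auto intro!: continuous_intros\<close>)
    \<comment> \<open>The bound holds at rational arguments and extends to real ones by density, the
      clamped function being continuous on the whole line.\<close>
    then have "f \<omega> (max a (min c t)) \<le> S c \<omega>"
    proof (rule continuous_le_on_closure[where S="\<rat> :: real set", unfolded Rats_closure_real])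
      show "f \<omega> (max a (min c q)) \<le> S c \<omega>" if "q \<in> \<rat>" for q
        unfolding S_def by (rule cSUP_upper[OF that bdd[OF c \<omega>]])
    qed simp
    then show ?thesis using t by simp
  qed
  have S_attained: "\<exists>t\<in>{a..c}. f \<omega> t = S c \<omega>" if c: "c \<in> {a..b}" and \<omega>: "\<omega> \<in> space M" for c \<omega>
  proof -
    obtain t where t: "t \<in> {a..c}" "\<And>s. s \<in> {a..c} \<Longrightarrow> f \<omega> s \<le> f \<omega> t"
      using continuous_attains_sup[of "{a..c}" "f \<omega>"] c continuous_on_subset[OF cont[OF \<omega>], of "{a..c}"] by auto
    have "S c \<omega> \<le> f \<omega> t" unfolding S_def
      by (rule cSUP_least) (use t c Rats_0 in \<open>auto simp del: Rats_0\<close>)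
    then show ?thesis using S_ge[OF c \<omega> t(1)] t by (intro bexI[of _ t]) auto
  qed
  define A where "A \<omega> = {t\<in>{a..b}. f \<omega> t = S b \<omega>}" for \<omega>
  define Z where "Z \<omega> = Inf (A \<omega>)" for \<omega>
  have b: "b \<in> {a..b}" using ab by simp
  have A: "A \<omega> \<noteq> {}" "bdd_below (A \<omega>)" "closed (A \<omega>)" if \<omega>: "\<omega> \<in> space M" for \<omega>
  proof -
    show "A \<omega> \<noteq> {}" using S_attained[OF b \<omega>] unfolding A_def by auto
    show "bdd_below (A \<omega>)" unfolding A_def by (rule bdd_belowI[of _ a]) auto
    show "closed (A \<omega>)" unfolding A_def
      by (intro continuous_closed_preimage_constant cont \<omega>) auto
  qed
  have Z_mem: "Z \<omega> \<in> A \<omega>" if "\<omega> \<in> space M" for \<omega>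
    unfolding Z_def by (rule closed_contains_Inf) (use A that in auto)
  have Z_le: "Z \<omega> \<le> c \<longleftrightarrow> S b \<omega> \<le> S c \<omega>" if c: "c \<in> {a..b}" and \<omega>: "\<omega> \<in> space M" for c \<omega>
  proof
    assume "Z \<omega> \<le> c"
    then show "S b \<omega> \<le> S c \<omega>" using Z_mem[OF \<omega>] S_ge[OF c \<omega>, of "Z \<omega>"] unfolding A_def by auto
  next
    assume le: "S b \<omega> \<le> S c \<omega>"
    obtain t where t: "t \<in> {a..c}" "f \<omega> t = S c \<omega>" using S_attained[OF c \<omega>] by auto
    then have "t \<in> A \<omega>" using S_ge[OF b \<omega>, of t] c le unfolding A_def by auto
    then have "Z \<omega> \<le> t" unfolding Z_def by (rule cInf_lower) (rule A(2)[OF \<omega>])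
    then show "Z \<omega> \<le> c" using t by auto
  qed
  have "Z \<in> borel_measurable M"
  proof (rule borel_measurableI_le)
    fix c
    consider "c < a" | "c > b" | "c \<in> {a..b}" by force
    then show "{\<omega> \<in> space M. Z \<omega> \<le> c} \<in> sets M"
    proof cases
      case 1
      then have "{\<omega> \<in> space M. Z \<omega> \<le> c} = {}" using Z_mem unfolding A_def by force
      then show ?thesis by (simp only: sets.empty_sets)
    next
      case 2
      then have "{\<omega> \<in> space M. Z \<omega> \<le> c} = space M" using Z_mem unfolding A_def by force
      then show ?thesis by simp
    next
      case 3
      note [measurable] = S_meas[OF 3] S_meas[OF b]
      have "{\<omega> \<in> space M. Z \<omega> \<le> c} = {\<omega> \<in> space M. S b \<omega> \<le> S c \<omega>}" using Z_le[OF 3] by auto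
      also have "\<dots> \<in> sets M" by measurable
      finally show ?thesis .
    qed
  qed
  moreover have "\<forall>\<omega>\<in>space M. Z \<omega> \<in> {a..b} \<and> (\<forall>t\<in>{a..b}. f \<omega> t \<le> f \<omega> (Z \<omega>))"
    using Z_mem S_ge[OF b] unfolding A_def by auto
  ultimately show ?thesis by blast
qed

text \<open>The index grows so slowly that, once \<open>n\<close> is large, \<open>p j n\<close> is
  within \<open>1 / (j + 1)\<close> of 1 at the selected \<open>j = m n\<close>.\<close>

lemma diagonal_sequence:
  fixes p :: "nat \<Rightarrow> nat \<Rightarrow> real"
  assumes lim: "\<And>j. p j \<longlonglongrightarrow> 1" and le: "\<And>j n. p j n \<le> 1"
  shows "\<exists>m. filterlim m at_top sequentially \<and> (\<lambda>n. p (m n) n) \<longlonglongrightarrow> 1"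
proof -
  have "\<exists>N. \<forall>n\<ge>N. 1 - 1 / real (Suc j) < p j n" for j
    using order_tendstoD(1)[OF lim[of j], of "1 - 1 / real (Suc j)"] by (simp add: eventually_sequentially)
  then obtain N where N: "\<And>j n. N j \<le> n \<Longrightarrow> 1 - 1 / real (Suc j) < p j n" by metis
  \<comment> \<open>The cap \<open>j \<le> n\<close> makes the set finite, and admitting
    \<open>j = 0\<close> unconditionally keeps it nonempty while \<open>n\<close> is below
    \<open>N 0\<close>.\<close>
  define m where "m n = Max {j. j \<le> n \<and> (j = 0 \<or> N j \<le> n)}" for n
  have fin: "finite {j. j \<le> n \<and> (j = 0 \<or> N j \<le> n)}" for n by (rule finite_subset[of _ "{..n}"]) auto
  have m_ge: "j \<le> m n" if "j \<le> n" "N j \<le> n" for j n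
    unfolding m_def by (rule Max_ge[OF fin]) (use that in auto)
  have m_mem: "m n = 0 \<or> N (m n) \<le> n" for n
    using Max_in[OF fin[of n]] unfolding m_def[symmetric] by auto
  have m_top: "filterlim m at_top sequentially"
    unfolding filterlim_at_top
  proof
    fix j show "\<forall>\<^sub>F n in sequentially. j \<le> m n"
      using eventually_ge_at_top[of j] eventually_ge_at_top[of "N j"] by eventually_elim (rule m_ge)
  qed
  have ev: "\<forall>\<^sub>F n in sequentially. 1 - 1 / real (Suc (m n)) \<le> p (m n) n"
    using eventually_ge_at_top[of "N 0"]
  proof eventually_elim
    case (elim n)
    then have "N (m n) \<le> n" using m_mem[of n] by auto
    then show ?case using N[of "m n" n] by simp
  qed
  have "(\<lambda>j. 1 - 1 / real (Suc j)) \<longlonglongrightarrow> 1 - 0"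
    by (intro tendsto_diff tendsto_const) (rule lim_1_over_n[THEN LIMSEQ_Suc])
  then have lower: "(\<lambda>n. 1 - 1 / real (Suc (m n))) \<longlonglongrightarrow> 1"
    using filterlim_compose[OF _ m_top] by fastforce
  have "(\<lambda>n. p (m n) n) \<longlonglongrightarrow> 1"
    by (rule tendsto_sandwich[OF ev _ lower tendsto_const]) (simp add: le)
  with m_top show ?thesis by blast
qed

locale robust_tail_index =
  regularly_varying_sample M X F \<gamma>\<^sub>0 k + robust_weight J \<alpha>
  for M :: "'a measure" and X F \<gamma>\<^sub>0 k J \<alpha>
begin

section \<open>Convergence in probability of the empirical objective\<close>

definition summand :: "real \<Rightarrow> nat \<Rightarrow> nat \<Rightarrow> 'a \<Rightarrow> real" where
  "summand g n i \<omega> = J (real i / real (k n + 1)) * ell_J J g (relative_excess n i \<omega>) powr \<alpha>"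

definition empirical :: "nat \<Rightarrow> real \<Rightarrow> 'a \<Rightarrow> real" where
  "empirical n g \<omega> = 1 / real (k n) * (\<Sum>i=1..k n. summand g n i \<omega>)"

text \<open>The rank average becomes the integral of a random step function: on
  \<open>((i - 1) / k, i / k]\<close> its value is the \<open>i\<close>-th summand. Fubini and
  dominated convergence in \<open>s\<close> are then available.\<close>

definition step_function :: "real \<Rightarrow> nat \<Rightarrow> real \<Rightarrow> 'a \<Rightarrow> real" where
  "step_function g n s \<omega> =
     (\<Sum>i=1..k n. indicator {(real i - 1) / real (k n)<..real i / real (k n)} s * summand g n i \<omega>)"

lemma summand_rv [measurable]: "summand g n i \<in> borel_measurable M"
  unfolding summand_def[abs_def] by measurable

lemma step_function_eq:
  "step_function g n s \<omega> =
     (if nat \<lceil>s * real (k n)\<rceil> \<in> {1..k n} then summand g n (nat \<lceil>s * real (k n)\<rceil>) \<omega> else 0)"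
proof -
  have "indicator {(real i - 1) / real (k n)<..real i / real (k n)} s
      = (if i = nat \<lceil>s * real (k n)\<rceil> then 1 else (0::real))" if i: "i \<in> {1..k n}" for i
  proof -
    have k: "real (k n) > 0" using i by auto
    have "s \<in> {(real i - 1) / real (k n)<..real i / real (k n)} \<longleftrightarrow> \<lceil>s * real (k n)\<rceil> = int i"
      using k by (simp add: ceiling_eq_iff field_simps)
    also have "\<dots> \<longleftrightarrow> i = nat \<lceil>s * real (k n)\<rceil>" using i by auto
    finally show ?thesis by (simp add: indicator_def)
  qed
  then have "step_function g n s \<omega> = (\<Sum>i=1..k n. if i = nat \<lceil>s * real (k n)\<rceil> then summand g n i \<omega> else 0)"
    unfolding step_function_def by (intro sum.cong) auto
  then show ?thesis by (simp add: sum.delta')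
qed

lemma integral_step_function:
  "integrable lborel (\<lambda>s. step_function g n s \<omega>)"
  "(\<integral>s. step_function g n s \<omega> \<partial>lborel) = empirical n g \<omega>"
proof -
  have int: "integrable lborel (\<lambda>s. indicator {(real i - 1) / real (k n)<..real i / real (k n)} s * summand g n i \<omega>)" for i
    by (intro integrable_mult_left integrable_real_indicator) (auto simp: divide_right_mono)
  show "integrable lborel (\<lambda>s. step_function g n s \<omega>)"
    unfolding step_function_def by (intro Bochner_Integration.integrable_sum int)
  have "(\<integral>s. step_function g n s \<omega> \<partial>lborel) = (\<Sum>i=1..k n. (real i / real (k n) - (real i - 1) / real (k n)) * summand g n i \<omega>)"
    unfolding step_function_def
    by (subst Bochner_Integration.integral_sum) (auto intro!: int sum.cong simp: divide_right_mono)
  then show "(\<integral>s. step_function g n s \<omega> \<partial>lborel) = empirical n g \<omega>"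
    unfolding empirical_def by (simp add: sum_distrib_left flip: diff_divide_distrib)
qed

text \<open>At a fixed \<open>s\<close> the active index is the ceiling of \<open>s * k n\<close>,
  whose ratio to \<open>k n\<close> tends to \<open>s\<close>. So the limit of
  \<open>relative_excess\<close> applies, combined with continuity of \<open>J\<close> at
  \<open>s\<close>.\<close>

lemma step_function_tendsto:
  assumes g: "0 < g" and s: "0 < s" "s < 1"
  shows "tendsto_in_prob M (\<lambda>n. step_function g n s) (J s * ell_J J g (s powr (- \<gamma>\<^sub>0)) powr \<alpha>)"
proof -
  define i where "i n = nat \<lceil>s * real (k n)\<rceil>" for n
  have i_bounds: "\<forall>\<^sub>F n in sequentially. 1 \<le> i n \<and> i n \<le> k n"
    using k_bounds
  proof eventually_elim
    case (elim n)
    have "0 < s * real (k n)" using s elim by simp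
    moreover have "s * real (k n) \<le> 1 * real (k n)" using s by (intro mult_right_mono) auto
    ultimately show ?case unfolding i_def by linarith
  qed
  have i_lim: "(\<lambda>n. real (i n) / real (k n)) \<longlonglongrightarrow> s"
  proof (rule tendsto_sandwich)
    show "\<forall>\<^sub>F n in sequentially. s \<le> real (i n) / real (k n)"
      using k_bounds by eventually_elim (use s in \<open>simp add: i_def field_simps; linarith\<close>)
    show "\<forall>\<^sub>F n in sequentially. real (i n) / real (k n) \<le> s + 1 / real (k n)"
      using k_bounds
    proof eventually_elim
      case (elim n)
      have "0 \<le> s * real (k n)" using s by simp
      then have "real (i n) \<le> s * real (k n) + 1" unfolding i_def by linarith
      then show ?case using elim by (simp add: field_simps)
    qed
    have "(\<lambda>n. 1 / real (k n)) \<longlonglongrightarrow> 0"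
      using tendsto_inverse_0_at_top[OF filterlim_compose[OF filterlim_real_sequentially k_at_top]]
      by (simp add: inverse_eq_divide)
    then show "(\<lambda>n. s + 1 / real (k n)) \<longlonglongrightarrow> s" using tendsto_add[OF tendsto_const] by fastforce
  qed auto
  have "(\<lambda>n. (real (i n) / real (k n)) / (real (Suc (k n)) / real (k n))) \<longlonglongrightarrow> s / 1"
    by (intro tendsto_divide i_lim Suc_k_div_k) auto
  moreover have "\<forall>\<^sub>F n in sequentially. (real (i n) / real (k n)) / (real (Suc (k n)) / real (k n)) = real (i n) / real (k n + 1)"
    using k_bounds by eventually_elim simp
  ultimately have "(\<lambda>n. real (i n) / real (k n + 1)) \<longlonglongrightarrow> s"
    by (auto intro: Lim_transform_eventually)
  then have J_lim: "(\<lambda>n. J (real (i n) / real (k n + 1))) \<longlonglongrightarrow> J s"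
    by (rule isCont_tendsto_compose[OF J_isCont[OF s]])
  \<comment> \<open>The deterministic weights are treated as random variables, so that the
    continuous mapping lemma can combine them with the relative excess.\<close>
  have det: "tendsto_in_prob M (\<lambda>n \<omega>. J (real (i n) / real (k n + 1))) (J s)"
    unfolding tendsto_in_prob_def
  proof safe
    fix \<epsilon> :: real assume "\<epsilon> > 0"
    then have "\<forall>\<^sub>F n in sequentially. \<bar>J (real (i n) / real (k n + 1)) - J s\<bar> < \<epsilon>"
      using tendstoD[OF J_lim] by (simp add: dist_real_def)
    then have "\<forall>\<^sub>F n in sequentially. 0 = prob {\<omega> \<in> space M. \<epsilon> < \<bar>J (real (i n) / real (k n + 1)) - J s\<bar>}"
      by eventually_elim simp
    then show "(\<lambda>n. prob {\<omega> \<in> space M. \<epsilon> < \<bar>J (real (i n) / real (k n + 1)) - J s\<bar>}) \<longlonglongrightarrow> 0"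
      by (rule Lim_transform_eventually[OF tendsto_const])
  qed
  \<comment> \<open>Since \<open>s < 1\<close>, the limit point lies above 1, where
    \<open>ell_J\<close> is continuous; at 1 it may jump.\<close>
  have x: "1 < s powr (- \<gamma>\<^sub>0)" using powr_less_mono2_neg[of "- \<gamma>\<^sub>0" s 1] s \<gamma>\<^sub>0_pos by simp
  define f where "f p = snd p * ell_J J g (fst p) powr \<alpha>" for p :: "real \<times> real"
  have powr_cont: "isCont (\<lambda>x. x powr r) y" if "0 < y" for r y :: real
    using has_real_derivative_powr[OF that] by (rule DERIV_isCont)
  have J_cont: "isCont (\<lambda>x. J (x powr (- 1 / g))) (s powr (- \<gamma>\<^sub>0))"
    by (rule isCont_o2[OF powr_cont]) (use x powr_in_unit[OF x g] in \<open>auto intro: J_isCont\<close>)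
  have ell_cont: "isCont (\<lambda>x. ell_J J g x) (s powr (- \<gamma>\<^sub>0))"
    unfolding ell_J_def ell_def by (intro isCont_mult J_cont continuous_const powr_cont) (use x in auto)
  have "isCont (\<lambda>x. ell_J J g x powr \<alpha>) (s powr (- \<gamma>\<^sub>0))"
    by (rule isCont_o2[OF ell_cont powr_cont]) (rule ell_J_pos[OF x g])
  then have "isCont f (s powr (- \<gamma>\<^sub>0), J s)"
    unfolding f_def by (intro isCont_mult isCont_snd continuous_ident isCont_o2[OF isCont_fst[OF continuous_ident]]) simp
  then have "tendsto_in_prob M (\<lambda>n \<omega>. f (relative_excess n (i n) \<omega>, J (real (i n) / real (k n + 1)))) (f (s powr (- \<gamma>\<^sub>0), J s))"
    by (intro tendsto_in_prob_isCont2 relative_excess_tendsto i_bounds i_lim s det) auto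
  moreover have "\<forall>\<^sub>F n in sequentially. \<forall>\<omega>\<in>space M. f (relative_excess n (i n) \<omega>, J (real (i n) / real (k n + 1))) = step_function g n s \<omega>"
    using i_bounds by eventually_elim (simp add: step_function_eq f_def summand_def i_def)
  ultimately show ?thesis by (subst (asm) tendsto_in_prob_cong) (auto simp: f_def)
qed

lemma empirical_rv [measurable]: "empirical n g \<in> borel_measurable M"
  unfolding empirical_def[abs_def] by measurable

text \<open>Convergence in mean. By Fubini the mean deviation is at most the integral over
  \<open>s\<close> of the mean deviation of the step function; this integrand tends to 0 for almost
  every \<open>s\<close> and is dominated by a constant on the unit interval.\<close>

lemma empirical_tendsto:
  assumes g: "0 < g"
  shows "tendsto_in_prob M (\<lambda>n. empirical n g) (LBINT s:{0<..<1}. J s * ell_J J g (s powr (- \<gamma>\<^sub>0)) powr \<alpha>)"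
proof (rule tendsto_in_prob_of_expectation)
  define a where "a s = J s * ell_J J g (s powr (- \<gamma>\<^sub>0)) powr \<alpha>" for s
  define A where "A = (LBINT s:{0<..<1}. J s * ell_J J g (s powr (- \<gamma>\<^sub>0)) powr \<alpha>)"
  have a_0: "indicator {0<..<1} s *\<^sub>R a s = a s" for s
    using J_zero[of s] by (auto simp: indicator_def a_def)
  have a_int: "integrable lborel a"
    using J_ell_J_integrable[OF g, of "\<gamma>\<^sub>0"] unfolding set_integrable_def a_def[symmetric] a_0 .
  have A_eq: "A = (\<integral>s. a s \<partial>lborel)"
    unfolding A_def set_lebesgue_integral_def a_def[symmetric] a_0 ..
  have [measurable]: "a \<in> borel_measurable borel" unfolding a_def by measurable
  obtain B where B: "B > 0" "\<And>s. J s \<le> B" using J_bounded by blast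
  obtain C where C: "\<And>x. 0 \<le> x \<Longrightarrow> ell_J J g x powr \<alpha> \<le> C" using ell_J_powr_bounded[OF g \<alpha>_pos] by blast
  have C0: "C \<ge> 0" using C[of 0] powr_ge_zero order.trans by blast
  have a_bound: "0 \<le> a s" "a s \<le> B * C" for s
    unfolding a_def using B C J_nonneg by (auto intro!: mult_mono)
  have summand_bound: "0 \<le> summand g n i \<omega>" "summand g n i \<omega> \<le> B * C" if "\<omega> \<in> space M" for n i \<omega>
    unfolding summand_def using B C[OF relative_excess_nonneg[OF that]] J_nonneg by (auto intro!: mult_mono)
  \<comment> \<open>On \<open>{0..1}\<close> both functions lie between 0 and \<open>B * C\<close>.
    Outside it no index is active and \<open>J\<close> vanishes, so both are 0.\<close>
  have diff_bound: "\<bar>step_function g n s \<omega> - a s\<bar> \<le> B * C * indicator {0..1} s" if \<omega>: "\<omega> \<in> space M" for n s \<omega>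
  proof (cases "s \<in> {0..1}")
    case True
    have "0 \<le> step_function g n s \<omega>" "step_function g n s \<omega> \<le> B * C"
      unfolding step_function_eq using summand_bound[OF \<omega>] B C0 by auto
    then show ?thesis using a_bound[of s] True by auto
  next
    case False
    have "nat \<lceil>s * real (k n)\<rceil> \<notin> {1..k n}"
    proof
      assume *: "nat \<lceil>s * real (k n)\<rceil> \<in> {1..k n}"
      then have k: "real (k n) > 0" unfolding atLeastAtMost_iff by linarith
      from * have "0 < s * real (k n)" "s * real (k n) \<le> 1 * real (k n)"
        unfolding atLeastAtMost_iff by linarith+
      with k False show False by (auto simp: zero_less_mult_iff)
    qed
    moreover have "a s = 0" using J_zero[of s] False by (auto simp: a_def)
    ultimately show ?thesis using False by (simp only: step_function_eq) auto
  qed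
  have step_meas [measurable]: "(\<lambda>(\<omega>, s). step_function g n s \<omega>) \<in> borel_measurable (M \<Otimes>\<^sub>M lborel)" for n
    unfolding step_function_def by measurable
  have le: "(\<integral>\<^sup>+ \<omega>. ennreal \<bar>empirical n g \<omega> - A\<bar> \<partial>M)
     \<le> (\<integral>\<^sup>+ s. (\<integral>\<^sup>+ \<omega>. ennreal \<bar>step_function g n s \<omega> - a s\<bar> \<partial>M) \<partial>lborel)" for n
  proof -
    have "(\<integral>\<^sup>+ \<omega>. ennreal \<bar>empirical n g \<omega> - A\<bar> \<partial>M)
       \<le> (\<integral>\<^sup>+ \<omega>. (\<integral>\<^sup>+ s. ennreal \<bar>step_function g n s \<omega> - a s\<bar> \<partial>lborel) \<partial>M)"
    proof (rule nn_integral_mono)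
      fix \<omega>
      have int: "integrable lborel (\<lambda>s. step_function g n s \<omega> - a s)"
        by (intro Bochner_Integration.integrable_diff integral_step_function a_int)
      have "empirical n g \<omega> - A = (\<integral>s. step_function g n s \<omega> - a s \<partial>lborel)"
        unfolding A_eq integral_step_function(2)[symmetric]
        by (rule Bochner_Integration.integral_diff[symmetric]) (intro integral_step_function a_int)+
      then have "ennreal \<bar>empirical n g \<omega> - A\<bar> \<le> ennreal (\<integral>s. \<bar>step_function g n s \<omega> - a s\<bar> \<partial>lborel)"
        using integral_abs_bound[of lborel "\<lambda>s. step_function g n s \<omega> - a s"] by (intro ennreal_leI) simp
      also have "\<dots> = (\<integral>\<^sup>+ s. ennreal \<bar>step_function g n s \<omega> - a s\<bar> \<partial>lborel)"
        by (rule nn_integral_eq_integral[symmetric]) (use int in auto)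
      finally show "ennreal \<bar>empirical n g \<omega> - A\<bar> \<le> \<dots>" .
    qed
    also have "\<dots> = (\<integral>\<^sup>+ s. (\<integral>\<^sup>+ \<omega>. ennreal \<bar>step_function g n s \<omega> - a s\<bar> \<partial>M) \<partial>lborel)"
    proof -
      interpret pair_sigma_finite M lborel ..
      show ?thesis by (rule Fubini'[symmetric]) measurable
    qed
    finally show ?thesis .
  qed
  have "(\<lambda>n. \<integral>\<^sup>+ s. (\<integral>\<^sup>+ \<omega>. ennreal \<bar>step_function g n s \<omega> - a s\<bar> \<partial>M) \<partial>lborel) \<longlonglongrightarrow> (\<integral>\<^sup>+ s. 0 \<partial>(lborel :: real measure))"
  proof (rule nn_integral_dominated_convergence[where w="\<lambda>s. ennreal (B * C) * indicator {0..1} s"])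
    show "(\<lambda>s. \<integral>\<^sup>+ \<omega>. ennreal \<bar>step_function g n s \<omega> - a s\<bar> \<partial>M) \<in> borel_measurable lborel" for n
    proof -
      have "(\<lambda>(s, \<omega>). ennreal \<bar>step_function g n s \<omega> - a s\<bar>) \<in> borel_measurable (lborel \<Otimes>\<^sub>M M)"
        unfolding step_function_def by measurable
      then show ?thesis by (rule borel_measurable_nn_integral)
    qed
    show "AE s in lborel. (\<integral>\<^sup>+ \<omega>. ennreal \<bar>step_function g n s \<omega> - a s\<bar> \<partial>M) \<le> ennreal (B * C) * indicator {0..1} s" for n
    proof (rule AE_I2)
      fix s :: real
      have "(\<integral>\<^sup>+ \<omega>. ennreal \<bar>step_function g n s \<omega> - a s\<bar> \<partial>M) \<le> (\<integral>\<^sup>+ \<omega>. ennreal (B * C * indicator {0..1} s) \<partial>M)"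
        using diff_bound by (intro nn_integral_mono ennreal_leI) auto
      also have "\<dots> = ennreal (B * C) * indicator {0..1} s"
        by (simp add: emeasure_space_1 indicator_def)
      finally show "(\<integral>\<^sup>+ \<omega>. ennreal \<bar>step_function g n s \<omega> - a s\<bar> \<partial>M) \<le> ennreal (B * C) * indicator {0..1} s" .
    qed
    have "(\<integral>\<^sup>+ s. ennreal (B * C) * indicator {0..1} (s::real) \<partial>lborel) = ennreal (B * C)"
      by (subst nn_integral_cmult_indicator) auto
    then show "(\<integral>\<^sup>+ s. ennreal (B * C) * indicator {0..1} (s::real) \<partial>lborel) < \<infinity>" by simp
    have lim: "(\<lambda>n. \<integral>\<^sup>+ \<omega>. ennreal \<bar>step_function g n s \<omega> - a s\<bar> \<partial>M) \<longlonglongrightarrow> 0" if "s \<noteq> 0" "s \<noteq> 1" for s :: real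
    proof (cases "s \<in> {0<..<1}")
      case True
      have meas: "step_function g n s \<in> borel_measurable M" for n
        unfolding step_function_def[abs_def] by measurable
      have bnd: "\<bar>step_function g n s \<omega> - a s\<bar> \<le> B * C" if "\<omega> \<in> space M" for n \<omega>
        using diff_bound[OF that, of n s] True by simp
      have "(\<lambda>n. expectation (\<lambda>\<omega>. \<bar>step_function g n s \<omega> - a s\<bar>)) \<longlonglongrightarrow> 0"
        using step_function_tendsto[OF g, of s] True unfolding a_def[symmetric]
        by (intro tendsto_in_prob_expectation_abs[OF meas _ bnd]) auto
      then have "(\<lambda>n. ennreal (expectation (\<lambda>\<omega>. \<bar>step_function g n s \<omega> - a s\<bar>))) \<longlonglongrightarrow> ennreal 0"
        by (rule tendsto_ennrealI)
      moreover have "(\<integral>\<^sup>+ \<omega>. ennreal \<bar>step_function g n s \<omega> - a s\<bar> \<partial>M) = ennreal (expectation (\<lambda>\<omega>. \<bar>step_function g n s \<omega> - a s\<bar>))" for n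
      proof (rule nn_integral_eq_integral)
        show "integrable M (\<lambda>\<omega>. \<bar>step_function g n s \<omega> - a s\<bar>)"
          by (rule integrable_const_bound[of _ "B * C"]) (use meas bnd in auto)
      qed auto
      ultimately show ?thesis by simp
    next
      case False
      then have "s \<notin> {0..1}" using that by auto
      then have "(\<integral>\<^sup>+ \<omega>. ennreal \<bar>step_function g n s \<omega> - a s\<bar> \<partial>M) = (\<integral>\<^sup>+ \<omega>. 0 \<partial>M)" for n
        using diff_bound[of _ n s] by (intro nn_integral_cong) auto
      then show ?thesis by simp
    qed
    \<comment> \<open>The endpoints are left out as a null set, because the pointwise limit inside
      is established only for \<open>0 < s < 1\<close>.\<close>
    show "AE s in lborel. (\<lambda>n. \<integral>\<^sup>+ \<omega>. ennreal \<bar>step_function g n s \<omega> - a s\<bar> \<partial>M) \<longlonglongrightarrow> 0"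
      using AE_lborel_singleton[of 0] AE_lborel_singleton[of 1] by eventually_elim (rule lim)
  qed auto
  then have "(\<lambda>n. \<integral>\<^sup>+ s. (\<integral>\<^sup>+ \<omega>. ennreal \<bar>step_function g n s \<omega> - a s\<bar> \<partial>M) \<partial>lborel) \<longlonglongrightarrow> 0" by simp
  from tendsto_sandwich[OF _ always_eventually[OF allI[OF le]] tendsto_const this]
  show "(\<lambda>n. \<integral>\<^sup>+ \<omega>. ennreal \<bar>empirical n g \<omega> - (LBINT s:{0<..<1}. J s * ell_J J g (s powr (- \<gamma>\<^sub>0)) powr \<alpha>)\<bar> \<partial>M) \<longlonglongrightarrow> 0"
    unfolding A_def by simp
qed simp

definition objective :: "nat \<Rightarrow> real \<Rightarrow> 'a \<Rightarrow> real" where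
  "objective n g \<omega> = empirical n g \<omega> - \<alpha> / (\<alpha> + 1) * (LBINT x:{1<..}. ell_J J g x powr (1 + \<alpha>))"

lemma objective_rv [measurable]: "objective n g \<in> borel_measurable M"
  unfolding objective_def[abs_def] by measurable

lemma objective_tendsto:
  assumes "0 < g"
  shows "tendsto_in_prob M (\<lambda>n. objective n g) (limit_objective \<gamma>\<^sub>0 g)"
  unfolding objective_def limit_objective_def
  by (rule tendsto_in_prob_isCont[OF empirical_rv empirical_tendsto[OF assms]]) simp

lemma prob_objective_less:
  assumes g: "0 < g" "g \<noteq> \<gamma>\<^sub>0"
  shows "(\<lambda>n. prob {\<omega> \<in> space M. \<not> objective n g \<omega> < objective n \<gamma>\<^sub>0 \<omega>}) \<longlonglongrightarrow> 0"
proof -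
  \<comment> \<open>The limits are \<open>3 * \<delta>\<close> apart, so if both objective values
    are within \<open>\<delta>\<close> of their limits, a gap of at least \<open>\<delta>\<close>
    remains.\<close>
  define \<delta> where "\<delta> = (limit_objective \<gamma>\<^sub>0 \<gamma>\<^sub>0 - limit_objective \<gamma>\<^sub>0 g) / 3"
  have \<delta>: "\<delta> > 0" using limit_objective_less[OF g(1) \<gamma>\<^sub>0_pos g(2)] by (simp add: \<delta>_def)
  let ?B = "\<lambda>n g. {\<omega> \<in> space M. \<bar>objective n g \<omega> - limit_objective \<gamma>\<^sub>0 g\<bar> > \<delta>}"
  have sub: "{\<omega> \<in> space M. \<not> objective n g \<omega> < objective n \<gamma>\<^sub>0 \<omega>} \<subseteq> ?B n g \<union> ?B n \<gamma>\<^sub>0" for n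
    using \<delta> unfolding \<delta>_def by (auto simp: abs_if field_simps split: if_splits)
  have le: "prob {\<omega> \<in> space M. \<not> objective n g \<omega> < objective n \<gamma>\<^sub>0 \<omega>} \<le> prob (?B n g) + prob (?B n \<gamma>\<^sub>0)" for n
    by (rule order.trans[OF finite_measure_mono[OF sub] measure_Un_le]) measurable
  have lim: "(\<lambda>n. prob (?B n g) + prob (?B n \<gamma>\<^sub>0)) \<longlonglongrightarrow> 0"
    using tendsto_add[OF objective_tendsto[OF g(1), unfolded tendsto_in_prob_def, rule_format, OF \<delta>]
      objective_tendsto[OF \<gamma>\<^sub>0_pos, unfolded tendsto_in_prob_def, rule_format, OF \<delta>]] by simp
  show ?thesis
    by (rule tendsto_sandwich[OF _ always_eventually[OF allI[OF le]] tendsto_const lim]) simp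
qed

section \<open>From maximisers to consistent solutions\<close>

text \<open>Keeping \<open>deriv\<close> in the summands makes the derivative literally the
  difference of the two sides of the estimating equation. This uses differentiability for every
  nonnegative ratio, including those at most 1.\<close>

lemma objective_has_derivative:
  assumes "\<omega> \<in> space M" "0 < g" 
  shows "((\<lambda>g. objective n g \<omega>) has_real_derivative
     1 / real (k n) * (\<Sum>i=1..k n. J (real i / real (k n + 1)) *
        deriv (\<lambda>g. ell_J J g (relative_excess n i \<omega>) powr \<alpha>) g)
     - \<alpha> / (\<alpha> + 1) * (LBINT x:{1<..}. deriv (\<lambda>g. ell_J J g x powr (1 + \<alpha>)) g)) (at g)"
  unfolding objective_def empirical_def summand_def
  by (intro DERIV_diff DERIV_cmult DERIV_sum ell_J_powr_integral_has_derivative assms(2))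
    (simp add: DERIV_deriv_iff_real_differentiable ell_J_powr_differentiable assms relative_excess_nonneg)

lemma estimating_eqI:
  assumes "\<omega> \<in> space M" "1 < k n" "k n < n" and g: "0 < g" and d: "0 < d"
    and max: "\<And>h. \<bar>g - h\<bar> < d \<Longrightarrow> objective n h \<omega> \<le> objective n g \<omega>"
  shows "estimating_eq X J \<alpha> n (k n) \<omega> g"
proof -
  have "relative_excess n i \<omega> = order_stat X n (n - i + 1) \<omega> / order_stat X n (n - k n) \<omega>" if "i \<in> {1..k n}" for i
    using that assms by (simp add: relative_excess_def)
  then show ?thesis
    using DERIV_local_max[OF objective_has_derivative[OF assms(1) g, of n] d] max
    unfolding estimating_eq_def by simp
qed

text \<open>The event that forces an interior maximum within \<open>\<epsilon>\<close> of
  \<open>\<gamma>\<^sub>0\<close>. It refers to three parameter values only, so it is measurable and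
  its probability follows from pointwise convergence.\<close>

definition peak :: "real \<Rightarrow> nat \<Rightarrow> 'a set" where
  "peak \<epsilon> n = {\<omega> \<in> space M. objective n (\<gamma>\<^sub>0 - \<epsilon>) \<omega> < objective n \<gamma>\<^sub>0 \<omega> \<and> objective n (\<gamma>\<^sub>0 + \<epsilon>) \<omega> < objective n \<gamma>\<^sub>0 \<omega>}"

lemma peak_sets [measurable]: "peak \<epsilon> n \<in> events"
  unfolding peak_def by measurable

lemma prob_peak:
  assumes "0 < \<epsilon>" "\<epsilon> < \<gamma>\<^sub>0"
  shows "(\<lambda>n. prob (peak \<epsilon> n)) \<longlonglongrightarrow> 1"
proof -
  let ?B = "\<lambda>n g. {\<omega> \<in> space M. \<not> objective n g \<omega> < objective n \<gamma>\<^sub>0 \<omega>}"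
  have "space M - peak \<epsilon> n \<subseteq> ?B n (\<gamma>\<^sub>0 - \<epsilon>) \<union> ?B n (\<gamma>\<^sub>0 + \<epsilon>)" for n
    unfolding peak_def by auto
  then have compl_le: "prob (space M - peak \<epsilon> n) \<le> prob (?B n (\<gamma>\<^sub>0 - \<epsilon>)) + prob (?B n (\<gamma>\<^sub>0 + \<epsilon>))" for n
    by (rule order.trans[OF finite_measure_mono measure_Un_le]) measurable
  then have le: "1 - (prob (?B n (\<gamma>\<^sub>0 - \<epsilon>)) + prob (?B n (\<gamma>\<^sub>0 + \<epsilon>))) \<le> prob (peak \<epsilon> n)" for n
    using prob_compl[OF peak_sets[of \<epsilon> n]] compl_le[of n] by linarith
  have "(\<lambda>n. 1 - (prob (?B n (\<gamma>\<^sub>0 - \<epsilon>)) + prob (?B n (\<gamma>\<^sub>0 + \<epsilon>)))) \<longlonglongrightarrow> 1 - (0 + 0)"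
    by (intro tendsto_diff tendsto_add tendsto_const prob_objective_less) (use assms in auto)
  then have lim: "(\<lambda>n. 1 - (prob (?B n (\<gamma>\<^sub>0 - \<epsilon>)) + prob (?B n (\<gamma>\<^sub>0 + \<epsilon>)))) \<longlonglongrightarrow> 1" by simp
  show ?thesis
    by (rule tendsto_sandwich[OF always_eventually[OF allI[OF le]] _ lim tendsto_const]) simp
qed

text \<open>On the peak event neither endpoint can be a maximiser over the closed interval, so the
  measurable maximiser is interior. The bounds on \<open>k n\<close> are premises inside the claim,
  because they hold only for large \<open>n\<close> while \<open>Z\<close> is wanted for all
  \<open>n\<close>.\<close>

lemma solution_near:
  assumes \<epsilon>: "0 < \<epsilon>" "\<epsilon> < \<gamma>\<^sub>0"
  shows "\<exists>Z\<in>borel_measurable M. \<forall>\<omega>\<in>peak \<epsilon> n. 0 < Z \<omega> \<and> \<bar>Z \<omega> - \<gamma>\<^sub>0\<bar> < \<epsilon> \<and>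
     (1 < k n \<longrightarrow> k n < n \<longrightarrow> estimating_eq X J \<alpha> n (k n) \<omega> (Z \<omega>))"
proof -
  have "continuous_on {\<gamma>\<^sub>0 - \<epsilon>..\<gamma>\<^sub>0 + \<epsilon>} (\<lambda>g. objective n g \<omega>)" if "\<omega> \<in> space M" for \<omega>
    by (rule DERIV_continuous_on, rule has_field_derivative_at_within, rule objective_has_derivative)
      (use that \<epsilon> in auto)
  then have "\<exists>Z\<in>borel_measurable M. \<forall>\<omega>\<in>space M. Z \<omega> \<in> {\<gamma>\<^sub>0 - \<epsilon>..\<gamma>\<^sub>0 + \<epsilon>} \<and>
      (\<forall>t\<in>{\<gamma>\<^sub>0 - \<epsilon>..\<gamma>\<^sub>0 + \<epsilon>}. objective n t \<omega> \<le> objective n (Z \<omega>) \<omega>)"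
    using \<epsilon> by (intro measurable_argmax) auto
  then obtain Z where Z: "Z \<in> borel_measurable M"
    "\<And>\<omega>. \<omega> \<in> space M \<Longrightarrow> Z \<omega> \<in> {\<gamma>\<^sub>0 - \<epsilon>..\<gamma>\<^sub>0 + \<epsilon>}"
    "\<And>\<omega> t. \<omega> \<in> space M \<Longrightarrow> t \<in> {\<gamma>\<^sub>0 - \<epsilon>..\<gamma>\<^sub>0 + \<epsilon>} \<Longrightarrow> objective n t \<omega> \<le> objective n (Z \<omega>) \<omega>" by blast
  have "0 < Z \<omega> \<and> \<bar>Z \<omega> - \<gamma>\<^sub>0\<bar> < \<epsilon> \<and> (1 < k n \<longrightarrow> k n < n \<longrightarrow> estimating_eq X J \<alpha> n (k n) \<omega> (Z \<omega>))"
    if \<omega>: "\<omega> \<in> peak \<epsilon> n" for \<omega>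
  proof -
    have sp: "\<omega> \<in> space M" using \<omega> unfolding peak_def by auto
    have "objective n \<gamma>\<^sub>0 \<omega> \<le> objective n (Z \<omega>) \<omega>" using Z(3)[OF sp, of \<gamma>\<^sub>0] \<epsilon> by auto
    then have "Z \<omega> \<noteq> \<gamma>\<^sub>0 - \<epsilon>" "Z \<omega> \<noteq> \<gamma>\<^sub>0 + \<epsilon>" using \<omega> unfolding peak_def by auto
    then have near: "\<bar>Z \<omega> - \<gamma>\<^sub>0\<bar> < \<epsilon>" using Z(2)[OF sp] by auto
    then have pos: "0 < Z \<omega>" using \<epsilon> by linarith
    \<comment> \<open>The radius
      \<open>\<epsilon> - \<bar>Z \<omega> - \<gamma>\<^sub>0\<bar>\<close> is the distance from
      \<open>Z \<omega>\<close> to the nearer endpoint, so the ball stays inside the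
      interval.\<close>
    have "estimating_eq X J \<alpha> n (k n) \<omega> (Z \<omega>)" if "1 < k n" "k n < n"
    proof (rule estimating_eqI[OF sp that pos, of "\<epsilon> - \<bar>Z \<omega> - \<gamma>\<^sub>0\<bar>"])
      show "objective n h \<omega> \<le> objective n (Z \<omega>) \<omega>" if "\<bar>Z \<omega> - h\<bar> < \<epsilon> - \<bar>Z \<omega> - \<gamma>\<^sub>0\<bar>" for h
        using that by (intro Z(3)[OF sp]) auto
    qed (use near in simp)
    with near pos show ?thesis by blast
  qed
  with Z(1) show ?thesis by blast
qed

text \<open>A fixed radius gives solutions that are merely near \<open>\<gamma>\<^sub>0\<close>. A
  radius shrinking with \<open>n\<close>, slowly enough that the peak events keep probability
  tending to 1, gives solvability and consistency together.\<close>

lemma consistent_solution: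
  "\<exists>\<gamma>hat :: nat \<Rightarrow> 'a \<Rightarrow> real.
     (\<forall>n. \<gamma>hat n \<in> borel_measurable M) \<and>
     (\<lambda>n. prob {\<omega> \<in> space M. \<gamma>hat n \<omega> > 0 \<and> estimating_eq X J \<alpha> n (k n) \<omega> (\<gamma>hat n \<omega>)}) \<longlonglongrightarrow> 1 \<and>
     tendsto_in_prob M \<gamma>hat \<gamma>\<^sub>0"
proof -
  \<comment> \<open>The shift by 2 makes the radius smaller than \<open>\<gamma>\<^sub>0\<close>
    already at \<open>j = 0\<close>, which keeps the search interval within the positive
    parameters.\<close>
  define \<epsilon> where "\<epsilon> j = \<gamma>\<^sub>0 / real (j + 2)" for j
  have \<epsilon>: "0 < \<epsilon> j" "\<epsilon> j < \<gamma>\<^sub>0" for j using \<gamma>\<^sub>0_pos by (auto simp: \<epsilon>_def field_simps add_pos_nonneg)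
  obtain m where m: "filterlim m at_top sequentially" "(\<lambda>n. prob (peak (\<epsilon> (m n)) n)) \<longlonglongrightarrow> 1"
    using diagonal_sequence[of "\<lambda>j n. prob (peak (\<epsilon> j) n)"] prob_peak[OF \<epsilon>] by auto
  define E where "E n = peak (\<epsilon> (m n)) n" for n
  have [measurable]: "E n \<in> events" for n unfolding E_def by simp
  have E_space: "E n \<subseteq> space M" for n unfolding E_def peak_def by auto
  have "\<exists>Z\<in>borel_measurable M. \<forall>\<omega>\<in>E n. 0 < Z \<omega> \<and> \<bar>Z \<omega> - \<gamma>\<^sub>0\<bar> < \<epsilon> (m n) \<and>
     (1 < k n \<longrightarrow> k n < n \<longrightarrow> estimating_eq X J \<alpha> n (k n) \<omega> (Z \<omega>))" for n
    unfolding E_def by (rule solution_near[OF \<epsilon>])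
  then obtain Z where Z [measurable]: "\<And>n. Z n \<in> borel_measurable M"
    and Z_props: "\<And>n \<omega>. \<omega> \<in> E n \<Longrightarrow> 0 < Z n \<omega> \<and> \<bar>Z n \<omega> - \<gamma>\<^sub>0\<bar> < \<epsilon> (m n) \<and>
     (1 < k n \<longrightarrow> k n < n \<longrightarrow> estimating_eq X J \<alpha> n (k n) \<omega> (Z n \<omega>))"
    by metis
  \<comment> \<open>Off \<open>E n\<close> the estimator is negative, so the solution event is exactly \<open>E n\<close>; its measurability
    needs no regularity of the estimating equation.\<close>
  define \<gamma>hat where "\<gamma>hat n \<omega> = (if \<omega> \<in> E n then Z n \<omega> else - 1)" for n \<omega>
  have meas: "\<gamma>hat n \<in> borel_measurable M" for n unfolding \<gamma>hat_def[abs_def] by measurable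
  have "\<forall>\<^sub>F n in sequentially. prob (E n)
      = prob {\<omega> \<in> space M. \<gamma>hat n \<omega> > 0 \<and> estimating_eq X J \<alpha> n (k n) \<omega> (\<gamma>hat n \<omega>)}"
    using k_bounds
  proof eventually_elim
    case (elim n)
    have "{\<omega> \<in> space M. \<gamma>hat n \<omega> > 0 \<and> estimating_eq X J \<alpha> n (k n) \<omega> (\<gamma>hat n \<omega>)} = E n"
      using Z_props[of _ n] E_space[of n] elim by (auto simp: \<gamma>hat_def split: if_splits)
    then show ?case by simp
  qed
  then have sol: "(\<lambda>n. prob {\<omega> \<in> space M. \<gamma>hat n \<omega> > 0 \<and> estimating_eq X J \<alpha> n (k n) \<omega> (\<gamma>hat n \<omega>)}) \<longlonglongrightarrow> 1"
    using m(2) unfolding E_def[symmetric] by (rule Lim_transform_eventually[rotated])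
  have "tendsto_in_prob M \<gamma>hat \<gamma>\<^sub>0"
    unfolding tendsto_in_prob_def
  proof safe
    fix e :: real assume e: "e > 0"
    have "(\<lambda>j. \<gamma>\<^sub>0 / real (j + 2)) \<longlonglongrightarrow> 0"
      by (rule tendsto_divide_0[OF tendsto_const]) (rule filterlim_at_top_imp_at_infinity, rule filterlim_compose[OF filterlim_real_sequentially], rule filterlim_add_const_nat_at_top)
    then have "(\<lambda>n. \<epsilon> (m n)) \<longlonglongrightarrow> 0"
      unfolding \<epsilon>_def by (rule filterlim_compose[OF _ m(1)])
    then have "\<forall>\<^sub>F n in sequentially. \<epsilon> (m n) < e" using e by (intro order_tendstoD) auto
    then have ev: "\<forall>\<^sub>F n in sequentially. norm (prob {\<omega> \<in> space M. e < \<bar>\<gamma>hat n \<omega> - \<gamma>\<^sub>0\<bar>}) \<le> 1 - prob (E n)"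
    proof eventually_elim
      case (elim n)
      \<comment> \<open>Once the radius is below \<open>e\<close>, a deviation beyond
        \<open>e\<close> can occur only off \<open>E n\<close>.\<close>
      have "{\<omega> \<in> space M. e < \<bar>\<gamma>hat n \<omega> - \<gamma>\<^sub>0\<bar>} \<subseteq> space M - E n"
        using Z_props[of _ n] elim by (fastforce simp: \<gamma>hat_def)
      then have "prob {\<omega> \<in> space M. e < \<bar>\<gamma>hat n \<omega> - \<gamma>\<^sub>0\<bar>} \<le> prob (space M - E n)"
        by (intro finite_measure_mono) auto
      then show ?case by (simp add: prob_compl)
    qed
    have "(\<lambda>n. 1 - prob (E n)) \<longlonglongrightarrow> 1 - 1" using m(2) unfolding E_def by (intro tendsto_diff tendsto_const)
    then show "(\<lambda>n. prob {\<omega> \<in> space M. e < \<bar>\<gamma>hat n \<omega> - \<gamma>\<^sub>0\<bar>}) \<longlonglongrightarrow> 0"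
      using Lim_null_comparison[OF ev] by simp
  qed
  with meas sol show ?thesis by blast
qed

end

theorem theorem4p1:
  fixes M :: "'a measure" and X :: "nat \<Rightarrow> 'a \<Rightarrow> real" and F J :: "real \<Rightarrow> real"
    and \<gamma>\<^sub>0 \<alpha> :: real and k :: "nat \<Rightarrow> nat"
  assumes "prob_space M"
    and "iid_with_cdf M X F"
    and "\<And>i \<omega>. i \<ge> 1 \<Longrightarrow> \<omega> \<in> space M \<Longrightarrow> 0 \<le> X i \<omega>"
    and "continuous_on UNIV F"
    and "\<gamma>\<^sub>0 > 0"
    and "\<And>x. x > 0 \<Longrightarrow> ((\<lambda>u. (1 - F (u * x)) / (1 - F u)) \<longlongrightarrow> x powr (- 1 / \<gamma>\<^sub>0)) at_top"
    and "\<And>s. s \<notin> {0<..<1} \<Longrightarrow> J s = 0"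
    and "weight_A1 J" and "weight_A2 J" and "weight_A3 J"
    and "\<alpha> > 0"
    and "\<forall>\<^sub>F n in sequentially. 1 < k n \<and> k n < n"
    and "filterlim k at_top sequentially"
    and "(\<lambda>n. real (k n) / real n) \<longlonglongrightarrow> 0"
  shows "\<exists>\<gamma>hat :: nat \<Rightarrow> 'a \<Rightarrow> real.
           (\<forall>n. \<gamma>hat n \<in> borel_measurable M) \<and>
           (\<lambda>n. measure M {\<omega> \<in> space M. \<gamma>hat n \<omega> > 0 \<and>
                  estimating_eq X J \<alpha> n (k n) \<omega> (\<gamma>hat n \<omega>)}) \<longlonglongrightarrow> 1 \<and>
           tendsto_in_prob M \<gamma>hat \<gamma>\<^sub>0"
proof -
  interpret robust_tail_index M X F \<gamma>\<^sub>0 k J \<alpha>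
    using assms
    by (intro robust_tail_index.intro regularly_varying_sample.intro robust_weight.intro
        regularly_varying_sample_axioms.intro) auto
  show ?thesis by (rule consistent_solution)
qed

end
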